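(* If $c<2$, then there is a constant $C$ (depending only on $c$) such that $$\|\mathbf{T}_g\|\le C\Big(\sum_{n=2}^\infty|b_n|^2\,n\,\exp\big(-c\sqrt{\log n\,\log_2n}\big)\Big)^{1/2}$$ for every Dirichlet series $g(s)=\sum_{n\ge 1}b_nn^{-s}$ in $\mathcal{D}$. Conversely, if for some real $c$ there is a constant $C$ such that this inequality holds for every such $\mathbf{T}_g$, then $c\le2\sqrt2$.
   Context: $\mathcal{D}$ is the class of functions expressible as a Dirichlet series in some half-plane $\{s:\mathrm{Re}\,s>\theta\}$. $\log_2x=\log\log x$ for $x>e^e$, with the convention $\log_2x=1$ for $x\le e^e$. $\mathcal{H}^2$ is the Hilbert space of Dirichlet series $f(s)=\sum_{n\ge1}a_nn^{-s}$ with $\|f\|_{\mathcal{H}^2}^2=\sum_{n\ge1}|a_n|^2<\infty$. The Volterra operator with symbol $g$ is $\mathbf{T}_gf(s)=-\int_s^{+\infty}f(w)g'(w)\,dw$ (integral along the horizontal half-line from $s$, for $\mathrm{Re}\,s$ large enough), which is again a Dirichlet series; $\|\mathbf{T}_g\|$ denotes its operator norm on $\mathcal{H}^2$ ($+\infty$ if $\mathbf{T}_g$ is unbounded). *)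

theory Defs
  imports "HOL-Analysis.Analysis"
begin

text \<open>
  Coefficient sequences are functions on the natural numbers of which only the values at
  indices \<open>n \<ge> 1\<close> matter.  A function counts as equal to a Dirichlet series if it agrees with
  it in some half-plane; its values elsewhere are irrelevant to everything below.
\<close>

definition dirichlet_expansion :: "(nat \<Rightarrow> complex) \<Rightarrow> (complex \<Rightarrow> complex) \<Rightarrow> bool" where
  "dirichlet_expansion a f \<longleftrightarrow>
     (\<exists>\<theta>::real. \<forall>s. Re s > \<theta> \<longrightarrow> (\<lambda>n. a (Suc n) / of_nat (Suc n) powr s) sums f s)"

definition dirichlet_class :: "(complex \<Rightarrow> complex) set" where
  "dirichlet_class = {f. \<exists>a. dirichlet_expansion a f}"

text \<open>The choice is unique at all indices \<open>n \<ge> 1\<close>, by uniqueness of Dirichlet coefficients.\<close>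

definition dirichlet_coeff :: "(complex \<Rightarrow> complex) \<Rightarrow> nat \<Rightarrow> complex" where
  "dirichlet_coeff f = (SOME a. dirichlet_expansion a f)"

definition ennreal_sqrt :: "ennreal \<Rightarrow> ennreal" where
  "ennreal_sqrt x = (if x = \<infinity> then \<infinity> else ennreal (sqrt (enn2real x)))"

definition H2_norm :: "(complex \<Rightarrow> complex) \<Rightarrow> ennreal" where
  "H2_norm f =
     (if f \<in> dirichlet_class
      then ennreal_sqrt (\<Sum>n. ennreal ((cmod (dirichlet_coeff f (Suc n)))\<^sup>2))
      else \<infinity>)"

definition H2 :: "(complex \<Rightarrow> complex) set" where
  "H2 = {f \<in> dirichlet_class. H2_norm f < \<infinity>}"

text \<open>The half-line from \<open>s\<close> to \<open>+\<infinity>\<close> is parametrised as \<open>w = s + t\<close>, \<open>t \<ge> 0\<close>.\<close>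

definition volterra :: "(complex \<Rightarrow> complex) \<Rightarrow> (complex \<Rightarrow> complex) \<Rightarrow> complex \<Rightarrow> complex" where
  "volterra g f s = - (LBINT t:{0..}. f (s + of_real t) * deriv g (s + of_real t))"

definition volterra_norm :: "(complex \<Rightarrow> complex) \<Rightarrow> ennreal" where
  "volterra_norm g = (SUP f \<in> {f \<in> H2. H2_norm f \<le> 1}. H2_norm (volterra g f))"

definition loglog :: "real \<Rightarrow> real" where
  "loglog x = (if x > exp (exp 1) then ln (ln x) else 1)"

text \<open>The series is indexed so that the summation runs over \<open>n \<ge> 2\<close>; its value may be infinite.\<close>

definition weighted_norm :: "real \<Rightarrow> (nat \<Rightarrow> complex) \<Rightarrow> ennreal" where
  "weighted_norm c b =
     (let w = (\<lambda>n::nat. real n * exp (- c * sqrt (ln (real n) * loglog (real n))))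
      in ennreal_sqrt (\<Sum>n. ennreal ((cmod (b (n + 2)))\<^sup>2 * w (n + 2))))"

end

theory Submission
  imports Defs "HOL-Complex_Analysis.Cauchy_Integral_Formula" "HOL-Number_Theory.Prime_Powers"
    "HOL-Real_Asymp.Real_Asymp"
begin

text \<open>
  With \<open>a\<close> and \<open>b\<close> the coefficients of \<open>f\<close> and \<open>g\<close>, the \<open>n\<close>-th coefficient of \<open>T\<^sub>g f\<close> is
  \<open>(\<Sum>d dvd n. a (n div d) * b d * ln d) / ln n\<close>.  By Cauchy--Schwarz the upper bound follows from
  \<open>\<Sum>d dvd n, d \<ge> 2. (ln d)\<^sup>2 / w d \<le> C * (ln n)\<^sup>2\<close>, where \<open>w\<close> is the weight.  Rankin's trick bounds
  the sum of \<open>1 / d\<close> over the divisors \<open>d\<close> of \<open>n\<close> with \<open>ln d \<approx> j\<close> by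
  \<open>exp (- \<tau> * S\<^sup>2 / Y + o(S))\<close>, where \<open>S = sqrt (j * ln j)\<close>, \<open>Y = ln (ln n)\<close> and \<open>\<tau> < 1/2\<close> is
  arbitrary; since \<open>\<tau> * S\<^sup>2 / Y + 2 * Y \<ge> 2 * sqrt (2 * \<tau>) * S\<close>, dividing by \<open>(ln n)\<^sup>2 = exp (2 * Y)\<close>
  leaves \<open>exp (- \<kappa> * S)\<close> for any \<open>\<kappa> < 2\<close>.

  For the converse, let \<open>P\<close> be the set of primes in \<open>(N powr (9/16), N]\<close> with \<open>N = k^k\<close>, let \<open>f\<close> have
  constant coefficients on the divisors of \<open>\<Prod>P\<close>, and let \<open>g\<close> have coefficients \<open>1 / d\<close> on the
  products \<open>d\<close> of \<open>k\<close> distinct elements of \<open>P\<close>.  Averaging over the divisors of \<open>\<Prod>P\<close> bounds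
  \<open>T\<^sub>g f\<close> from below and yields \<open>E \<le> exp (o(k * ln k)) * N\<^sup>2 * exp (- c * S)\<close> for the elementary
  symmetric sum \<open>E\<close> of degree \<open>k\<close> of the \<open>1 / p\<close>, whereas \<open>E \<ge> exp (- O(k)) / fact k\<close>.  Only
  the first Mertens theorem, in the form obtained from \<open>fact N\<close>, is needed about primes.
\<close>

subsection \<open>Dirichlet series and the Volterra operator\<close>

lemma norm_dirichlet_term:
  assumes "n \<ge> 1"
  shows "cmod (z / of_nat n powr s) = cmod z * real n powr - Re s"
proof -
  have "cmod (of_nat n powr s) = real n powr Re s"
    using assms norm_powr_real_powr[of "of_nat n" s] by simp
  then show ?thesis
    by (simp add: norm_divide powr_minus divide_inverse norm_mult norm_inverse)
qed

text \<open>Convergence at a single real point already bounds the terms there, and this is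
  polynomial growth of the coefficients. All absolute convergence below is deduced from it.\<close>

lemma dirichlet_expansion_bound:
  assumes "dirichlet_expansion a f"
  obtains M K :: real where "M \<ge> 0" "K \<ge> 0" "\<And>n. n \<ge> 1 \<Longrightarrow> cmod (a n) \<le> M * real n powr K"
proof -
  obtain \<theta> where \<theta>: "\<And>s. Re s > \<theta> \<Longrightarrow> (\<lambda>n. a (Suc n) / of_nat (Suc n) powr s) sums f s"
    using assms unfolding dirichlet_expansion_def by blast
  define K where "K = max 0 (\<theta> + 1)"
  have "(\<lambda>n. a (Suc n) / of_nat (Suc n) powr of_real K) sums f (of_real K)"
    by (rule \<theta>) (simp add: K_def)
  then have "Bseq (\<lambda>n. a (Suc n) / of_nat (Suc n) powr of_real K)"
    using summable_imp_Bseq sums_summable by blast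
  then obtain M where M: "M > 0" "\<And>n. cmod (a (Suc n) / of_nat (Suc n) powr of_real K) \<le> M"
    unfolding Bseq_def by blast
  show ?thesis
  proof (rule that[of M K])
    fix n :: nat assume n: "n \<ge> 1"
    then obtain m where m: "n = Suc m" by (cases n) auto
    have "cmod (a n) * real n powr - K \<le> M"
      using M(2)[of m] norm_dirichlet_term[OF n, of "a n" "of_real K"] m by simp
    then show "cmod (a n) \<le> M * real n powr K"
      using n by (simp add: powr_minus field_simps)
  qed (use M(1) in \<open>auto simp: K_def\<close>)
qed

lemma summable_const_div_Suc_square:
  fixes M :: real
  shows "summable (\<lambda>n. M * (1 / real (Suc n) ^ 2))"
proof -
  have "summable (\<lambda>n. 1 / real n ^ 2)"
    using inverse_power_summable[of 2, where ?'a = real] by (simp add: inverse_eq_divide)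
  then show ?thesis
    by (intro summable_mult) (simp only: summable_Suc_iff[of "\<lambda>n. 1 / real n ^ 2"])
qed

text \<open>Two units to the right of the growth exponent the terms are dominated by
  \<open>M / n^2\<close>. The majorant does not depend on \<open>s\<close>, which termwise
  differentiation requires.\<close>

lemma norm_summable_dirichlet_term:
  fixes a :: "nat \<Rightarrow> complex"
  assumes bd: "\<And>n. n \<ge> 1 \<Longrightarrow> cmod (a n) \<le> M * real n powr K" and s: "Re s \<ge> K + 2"
  shows "summable (\<lambda>n. cmod (a (Suc n) / of_nat (Suc n) powr s))"
    and "cmod (a (Suc n) / of_nat (Suc n) powr s) \<le> M * (1 / real (Suc n) ^ 2)"
proof -
  have M: "M \<ge> 0" using bd[of 1] norm_ge_zero[of "a 1"] by (simp del: norm_ge_zero)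
  have *: "cmod (a (Suc n) / of_nat (Suc n) powr s) \<le> M * (1 / real (Suc n) ^ 2)" for n
  proof -
    have "cmod (a (Suc n) / of_nat (Suc n) powr s) = cmod (a (Suc n)) * real (Suc n) powr - Re s"
      by (rule norm_dirichlet_term) simp
    also have "\<dots> \<le> (M * real (Suc n) powr K) * real (Suc n) powr - Re s"
      by (intro mult_right_mono bd) auto
    also have "\<dots> = M * real (Suc n) powr (K - Re s)"
      by (simp add: powr_add[symmetric])
    also have "\<dots> \<le> M * real (Suc n) powr (-2)"
      using s M by (intro mult_left_mono powr_mono) auto
    also have "real (Suc n) powr (-2) = 1 / real (Suc n) ^ 2"
      by (simp add: powr_minus_divide powr_numeral)
    finally show ?thesis .
  qed
  then show "cmod (a (Suc n) / of_nat (Suc n) powr s) \<le> M * (1 / real (Suc n) ^ 2)" .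
  from summable_const_div_Suc_square[of M] show "summable (\<lambda>n. cmod (a (Suc n) / of_nat (Suc n) powr s))"
    by (rule summable_comparison_test') (use * in auto)
qed

text \<open>At the first index \<open>N\<close> where the coefficients differ, shift the real
  argument by \<open>t\<close>. The term of index \<open>N\<close> scales by
  \<open>N powr (- t)\<close> and the tail by at most \<open>(N + 1) powr (- t)\<close>. Since the
  difference series sums to 0, letting \<open>t\<close> tend to infinity forces
  \<open>c N = 0\<close>.\<close>

lemma dirichlet_expansion_unique:
  assumes "dirichlet_expansion a f" "dirichlet_expansion b f" "n \<ge> 1"
  shows "a n = b n"
proof (rule ccontr)
  assume "a n \<noteq> b n"
  define c where "c = (\<lambda>n. a n - b n)"
  define N where "N = (LEAST n. n \<ge> 1 \<and> c n \<noteq> 0)"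
  have N: "N \<ge> 1" "c N \<noteq> 0"
    using LeastI[of "\<lambda>n. n \<ge> 1 \<and> c n \<noteq> 0" n] \<open>a n \<noteq> b n\<close> assms(3) by (auto simp: N_def c_def)
  have N_least: "c m = 0" if "m \<ge> 1" "m < N" for m
    using not_less_Least[of m "\<lambda>n. n \<ge> 1 \<and> c n \<noteq> 0"] that by (auto simp: N_def)
  obtain \<theta>1 where \<theta>1: "\<And>s. Re s > \<theta>1 \<Longrightarrow> (\<lambda>n. a (Suc n) / of_nat (Suc n) powr s) sums f s"
    using assms(1) unfolding dirichlet_expansion_def by blast
  obtain \<theta>2 where \<theta>2: "\<And>s. Re s > \<theta>2 \<Longrightarrow> (\<lambda>n. b (Suc n) / of_nat (Suc n) powr s) sums f s"
    using assms(2) unfolding dirichlet_expansion_def by blast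
  define \<theta> where "\<theta> = max \<theta>1 \<theta>2"
  have sums0: "(\<lambda>n. c (Suc n) / of_nat (Suc n) powr s) sums 0" if "Re s > \<theta>" for s
    using sums_diff[OF \<theta>1[of s] \<theta>2[of s]] that
    by (simp add: \<theta>_def c_def diff_divide_distrib)
  have "dirichlet_expansion c (\<lambda>s. 0)"
    unfolding dirichlet_expansion_def using sums0 by blast
  then obtain M K where bd: "M \<ge> 0" "K \<ge> 0" "\<And>n. n \<ge> 1 \<Longrightarrow> cmod (c n) \<le> M * real n powr K"
    using dirichlet_expansion_bound by blast
  define \<sigma> where "\<sigma> = max (K + 2) (\<theta> + 1)"
  define q where "q = real N / real (Suc N)"
  have q: "0 < q" "q < 1" using N(1) by (auto simp: q_def)
  define h where "h = (\<lambda>n. cmod (c (Suc n) / of_nat (Suc n) powr of_real \<sigma>))"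
  have h: "summable h"
    unfolding h_def by (rule norm_summable_dirichlet_term[OF bd(3)]) (auto simp: \<sigma>_def)
  have "cmod (c N) * real N powr - \<sigma> \<le> q powr t * suminf h" if t: "t \<ge> 0" for t
  proof -
    define u where "u = (\<lambda>n. c (Suc n) / of_nat (Suc n) powr of_real (\<sigma> + t))"
    have u0: "u sums 0" unfolding u_def by (rule sums0) (use t in \<open>auto simp: \<sigma>_def\<close>)
    have nu: "summable (\<lambda>n. cmod (u n))"
      unfolding u_def by (rule norm_summable_dirichlet_term[OF bd(3)]) (use t in \<open>auto simp: \<sigma>_def\<close>)
    have "suminf u = (\<Sum>n. u (n + N)) + (\<Sum>i<N. u i)"
      by (rule suminf_split_initial_segment) (use u0 in \<open>simp add: sums_iff\<close>)
    \<comment> \<open>The sequence \<open>u\<close> is shifted by \<open>Suc\<close>, so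
      \<open>u (N - 1)\<close> is the term of index \<open>N\<close>; the earlier ones vanish by
      minimality.\<close>
    also have "(\<Sum>i<N. u i) = (\<Sum>i<N. if i = N - 1 then u (N - 1) else 0)"
      by (intro sum.cong refl) (use N_least in \<open>auto simp: u_def\<close>)
    also have "\<dots> = u (N - 1)" using N(1) by (simp add: sum.delta')
    finally have "u (N - 1) = - (\<Sum>n. u (n + N))" using u0 by (simp add: sums_iff add_eq_0_iff2)
    then have "cmod (u (N - 1)) \<le> (\<Sum>n. cmod (u (n + N)))"
      using summable_norm[of "\<lambda>n. u (n + N)"] nu by (simp add: summable_iff_shift[of "\<lambda>n. cmod (u n)" N])
    also have "\<dots> \<le> (\<Sum>n. real (Suc N) powr - t * h (n + N))"
    proof (rule suminf_le)
      fix n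
      have eq: "cmod (u m) = real (Suc m) powr - t * h m" for m
        unfolding u_def h_def by (subst (1 2) norm_dirichlet_term) (auto simp: powr_diff powr_minus field_simps)
      have "real (Suc (n + N)) powr - t \<le> real (Suc N) powr - t"
        using t by (intro powr_mono2') auto
      then show "cmod (u (n + N)) \<le> real (Suc N) powr - t * h (n + N)"
        unfolding eq by (intro mult_right_mono) (auto simp: h_def)
    next
      show "summable (\<lambda>n. cmod (u (n + N)))" using nu by (simp add: summable_iff_shift[of "\<lambda>n. cmod (u n)" N])
      show "summable (\<lambda>n. real (Suc N) powr - t * h (n + N))"
        using h by (intro summable_mult) (simp add: summable_iff_shift)
    qed
    also have "\<dots> = real (Suc N) powr - t * (\<Sum>n. h (n + N))"
      using h by (intro suminf_mult) (simp add: summable_iff_shift)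
    also have "\<dots> \<le> real (Suc N) powr - t * suminf h"
    proof (intro mult_left_mono)
      have "0 \<le> sum h {..<N}" by (intro sum_nonneg) (auto simp: h_def)
      then show "(\<Sum>n. h (n + N)) \<le> suminf h"
        using suminf_split_initial_segment[OF h, of N] by linarith
    qed auto
    finally have "cmod (u (N - 1)) \<le> real (Suc N) powr - t * suminf h" .
    moreover have "cmod (u (N - 1)) = cmod (c N) * real N powr - (\<sigma> + t)"
      using norm_dirichlet_term[OF N(1), of "c N" "of_real (\<sigma> + t)"] N(1) by (simp add: u_def)
    ultimately have "cmod (c N) * real N powr - \<sigma> * real N powr - t \<le> real (Suc N) powr - t * suminf h"
      by (simp add: powr_add[symmetric] mult.assoc)
    then show ?thesis
      using N(1) by (simp add: q_def powr_divide powr_minus field_simps)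
  qed
  moreover have "((\<lambda>t. q powr t * suminf h) \<longlongrightarrow> 0 * suminf h) at_top"
    using q by (intro tendsto_mult tendsto_const) real_asymp
  ultimately have "cmod (c N) * real N powr - \<sigma> \<le> 0 * suminf h"
    by (intro tendsto_lowerbound[where F = at_top and a = "cmod (c N) * real N powr - \<sigma>"])
       (auto intro: eventually_at_top_linorderI[of 0])
  moreover have "0 < cmod (c N) * real N powr - \<sigma>" using N by simp
  ultimately show False by simp
qed

lemma ennreal_sqrt_ennreal: "r \<ge> 0 \<Longrightarrow> ennreal_sqrt (ennreal r) = ennreal (sqrt r)"
  by (simp add: ennreal_sqrt_def)

text \<open>By uniqueness the coefficients picked by \<open>SOME\<close> agree with those of any
  known expansion, so the norm can be read off from whichever expansion is at hand.\<close>

lemma H2_norm_eq: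
  assumes "dirichlet_expansion a f"
  shows "H2_norm f = ennreal_sqrt (\<Sum>n. ennreal ((cmod (a (Suc n)))\<^sup>2))"
proof -
  have "f \<in> dirichlet_class" using assms by (auto simp: dirichlet_class_def)
  moreover have "dirichlet_expansion (dirichlet_coeff f) f"
    unfolding dirichlet_coeff_def using someI[of "\<lambda>a. dirichlet_expansion a f", OF assms] .
  then have "dirichlet_coeff f (Suc n) = a (Suc n)" for n
    using assms by (intro dirichlet_expansion_unique) auto
  ultimately show ?thesis by (simp add: H2_norm_def)
qed

text \<open>The product of the two absolutely convergent sums is a sum over pairs
  \<open>(m, d)\<close>, regrouped along \<open>n = m * d\<close>. The type is general because the
  lemma serves both for complex Dirichlet series and for real sums of squared moduli.\<close>

lemma dirichlet_convolution_has_sum: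
  fixes F G :: "nat \<Rightarrow> 'a :: {real_normed_field, banach}"
  assumes F: "(\<lambda>n. norm (F n)) summable_on {1..}" and G: "(\<lambda>n. norm (G n)) summable_on {1..}"
  shows "((\<lambda>n. \<Sum>d | d dvd n. F (n div d) * G d) has_sum (infsum F {1..} * infsum G {1..})) {1..}"
proof -
  have abs: "(\<lambda>x. norm ((\<lambda>(m, d). F m * G d) x)) summable_on {1..} \<times> {1..}"
  unfolding Infinite_Sum.abs_summable_on_Sigma_iff
  proof (intro conjI ballI)
    show "(\<lambda>y. norm ((\<lambda>(m, d). F m * G d) (x, y))) summable_on {1..}" for x
      using G by (simp add: norm_mult summable_on_cmult_right)
    have "(\<lambda>x. norm (F x) * (\<Sum>\<^sub>\<infinity>y\<in>{1..}. norm (G y))) summable_on {1..}"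
      using F by (rule summable_on_cmult_left)
    moreover have "(\<Sum>\<^sub>\<infinity>y\<in>{1..}. norm (G y)) \<ge> 0" by (rule infsum_nonneg) auto
    ultimately show "(\<lambda>x. norm (\<Sum>\<^sub>\<infinity>y\<in>{1..}. norm ((\<lambda>(m, d). F m * G d) (x, y)))) summable_on {1..}"
      using G by (simp add: norm_mult infsum_cmult_right' abs_mult)
  qed
  have F': "(F has_sum infsum F {1..}) {1..}" and G': "(G has_sum infsum G {1..}) {1..}"
    using F G by (auto intro: has_sum_infsum abs_summable_summable)
  have "((\<lambda>(m, d). F m * G d) has_sum (infsum F {1..} * infsum G {1..})) ({1..} \<times> {1..})"
  proof (rule has_sum_SigmaI)
    show "((\<lambda>y. (\<lambda>(m, d). F m * G d) (x, y)) has_sum F x * infsum G {1..}) {1..}" for x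
      using has_sum_cmult_right[OF G'] by simp
    show "((\<lambda>x. F x * infsum G {1..}) has_sum infsum F {1..} * infsum G {1..}) {1..}"
      using has_sum_cmult_left[OF F'] by simp
    show "(\<lambda>(m, d). F m * G d) summable_on {1..} \<times> {1..}"
      using abs by (rule abs_summable_summable)
  qed
  also have "?this \<longleftrightarrow> ((\<lambda>(n, d). F (n div d) * G d) has_sum (infsum F {1..} * infsum G {1..}))
      (SIGMA n:{1..}. {d. d dvd n})"
    by (rule has_sum_reindex_bij_witness[where i = "\<lambda>(n, d). (n div d, d)" and j = "\<lambda>(m, d). (m * d, d)"])
       (auto simp: Suc_le_eq intro!: Nat.gr0I dest: dvd_imp_le)
  finally have sum: "((\<lambda>(n, d). F (n div d) * G d) has_sum (infsum F {1..} * infsum G {1..}))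
      (SIGMA n:{1..}. {d. d dvd n})" .
  show ?thesis
  proof (rule has_sum_SigmaD[OF sum])
    fix n :: nat assume "n \<in> {1..}"
    then show "((\<lambda>d. (\<lambda>(n, d). F (n div d) * G d) (n, d)) has_sum
        (\<Sum>d | d dvd n. F (n div d) * G d)) {d. d dvd n}"
      by (auto intro!: has_sum_finite)
  qed
qed

lemma has_sum_Suc_iff:
  fixes u :: "nat \<Rightarrow> 'a :: topological_comm_monoid_add"
  shows "((\<lambda>n. u (Suc n)) has_sum S) UNIV \<longleftrightarrow> (u has_sum S) {1..}"
  by (rule has_sum_reindex_bij_witness[where i = "\<lambda>n. n - 1" and j = Suc]) auto

lemma norm_summable_sums_imp_has_sum_Suc:
  fixes u :: "nat \<Rightarrow> 'a :: banach"
  assumes "summable (\<lambda>n. norm (u (Suc n)))" "(\<lambda>n. u (Suc n)) sums S"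
  shows "(\<lambda>n. norm (u n)) summable_on {1..}" and "(u has_sum S) {1..}"
proof -
  have "((\<lambda>n. norm (u (Suc n))) has_sum suminf (\<lambda>n. norm (u (Suc n)))) UNIV"
    by (rule sums_nonneg_imp_has_sum) (use assms in \<open>auto simp: summable_sums\<close>)
  then show "(\<lambda>n. norm (u n)) summable_on {1..}"
    using has_sum_Suc_iff[of "\<lambda>n. norm (u n)"] by (auto simp: summable_on_def)
  show "(u has_sum S) {1..}"
    using norm_summable_imp_has_sum[OF assms] has_sum_Suc_iff[of u S] by simp
qed

section \<open>Termwise differentiation and integration\<close>

lemma of_nat_powr_complex:
  assumes "n \<ge> 1"
  shows "of_nat n powr s = exp (s * of_real (ln (real n)) :: complex)"
  using assms by (simp add: powr_def Ln_of_nat)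

lemma dirichlet_conv_term:
  fixes x y :: complex
  assumes "d dvd n" "n \<ge> 1"
  shows "(x / of_nat (n div d) powr s) * (y / of_nat d powr s) = x * y / of_nat n powr s"
proof -
  obtain m where n: "n = m * d" using assms(1) by (auto simp: dvd_def mult.commute)
  with assms have "m \<ge> 1" "d \<ge> 1" by auto
  then have "of_nat n powr s = of_nat m powr s * (of_nat d powr s :: complex)"
    using of_nat_powr_complex[of "m * d"] of_nat_powr_complex[of m] of_nat_powr_complex[of d]
    by (simp add: n ln_mult exp_add[symmetric] ring_distribs)
  moreover have "n div d = m" using n \<open>d \<ge> 1\<close> by simp
  ultimately show ?thesis by simp
qed

text \<open>With \<open>L = ln n\<close> the integrand is \<open>n powr (- t)\<close>; this is the
  source of the denominator \<open>ln n\<close> in \<open>volterra_coeff\<close>.\<close>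

lemma has_bochner_integral_exp_half_line:
  fixes L :: real
  assumes "L > 0"
  shows "has_bochner_integral lborel (\<lambda>t. indicator {0..} t * exp (- (t * L))) (1 / L)"
proof (rule has_bochner_integral_nn_integral)
  have "(\<integral>\<^sup>+t. ennreal (exp (- (t * L))) * indicator {0..} t \<partial>lborel) = 0 - (- exp (- (0 * L)) / L)"
  proof (rule nn_integral_FTC_atLeast)
    show "((\<lambda>t. - exp (- (t * L)) / L) has_real_derivative exp (- (x * L))) (at x)" for x
      using assms by (auto intro!: derivative_eq_intros)
    show "((\<lambda>t. - exp (- (t * L)) / L) \<longlongrightarrow> 0) at_top"
      using assms by real_asymp
  qed auto
  then show "(\<integral>\<^sup>+t. ennreal (indicator {0..} t * exp (- (t * L))) \<partial>lborel) = ennreal (1 / L)"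
    by (simp add: mult.commute ennreal_mult' ennreal_indicator)
qed (use assms in auto)

lemma has_field_derivative_dirichlet_term:
  fixes x s :: complex
  assumes "n \<ge> 1"
  shows "((\<lambda>s. x / of_nat n powr s) has_field_derivative
           - (x * of_real (ln (real n)) / of_nat n powr s)) (at s)"
proof -
  have "((\<lambda>s. x * exp (- (s * of_real (ln (real n))))) has_field_derivative
           - (x * of_real (ln (real n)) * exp (- (s * of_real (ln (real n)))))) (at s)"
    by (auto intro!: derivative_eq_intros)
  then show ?thesis
    using assms by (simp add: of_nat_powr_complex exp_minus divide_inverse)
qed

text \<open>The uniform majorant \<open>M / n^2\<close> on the half-plane permits termwise
  differentiation. The sum is stated for \<open>- deriv g\<close> so that the sign matches the one
  in \<open>volterra\<close>.\<close>

lemma deriv_dirichlet: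
  assumes bd: "\<And>n. n \<ge> 1 \<Longrightarrow> cmod (b n) \<le> M * real n powr K" and "\<theta> \<ge> K + 2"
    and g: "\<And>s. Re s > \<theta> \<Longrightarrow> (\<lambda>n. b (Suc n) / of_nat (Suc n) powr s) sums g s"
    and s: "Re s > \<theta>"
  shows "(\<lambda>n. b (Suc n) * of_real (ln (real (Suc n))) / of_nat (Suc n) powr s) sums (- deriv g s)"
proof -
  define S where "S = {s. Re s > \<theta>}"
  define h where "h = (\<lambda>n. M * (1 / real (Suc n) ^ 2))"
  have h: "summable h" unfolding h_def by (rule summable_const_div_Suc_square)
  have "open S" unfolding S_def by (rule open_halfspace_Re_gt)
  then obtain G G' where G: "\<forall>x\<in>S. ((\<lambda>n. b (Suc n) / of_nat (Suc n) powr x) sums G x) \<and>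
      ((\<lambda>n. - (b (Suc n) * of_real (ln (real (Suc n))) / of_nat (Suc n) powr x)) sums G' x) \<and>
      (G has_field_derivative G' x) (at x)"
  proof (rule series_and_derivative_comparison[OF _ h])
    show "((\<lambda>s. b (Suc n) / of_nat (Suc n) powr s) has_field_derivative
        - (b (Suc n) * of_real (ln (real (Suc n))) / of_nat (Suc n) powr x)) (at x)" for n x
      by (rule has_field_derivative_dirichlet_term) simp
    show "\<forall>\<^sub>F n in sequentially. \<forall>x\<in>S. cmod (b (Suc n) / of_nat (Suc n) powr x) \<le> h n"
      unfolding h_def S_def
      by (intro always_eventually allI ballI norm_summable_dirichlet_term(2)[OF bd])
         (use assms(2) in auto)
  qed blast
  have sS: "s \<in> S" using s by (simp add: S_def)
  have "G x = g x" if "x \<in> S" for x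
    using G that g[of x] sums_unique2 by (auto simp: S_def)
  then have "(g has_field_derivative G' s) (at s)"
    using G sS \<open>open S\<close> by (intro has_field_derivative_transform_within_open[of G _ s S g]) auto
  then have "deriv g s = G' s" by (rule DERIV_imp_deriv)
  moreover have "(\<lambda>n. - (- (b (Suc n) * of_real (ln (real (Suc n))) / of_nat (Suc n) powr s))) sums - G' s"
    using G sS by (intro sums_minus) auto
  ultimately show ?thesis by simp
qed

text \<open>At \<open>n = 1\<close> numerator and denominator both vanish, and division by zero
  yields the coefficient 0.\<close>

definition volterra_coeff :: "(nat \<Rightarrow> complex) \<Rightarrow> (nat \<Rightarrow> complex) \<Rightarrow> nat \<Rightarrow> complex" where
  "volterra_coeff b a n =
     (\<Sum>d | d dvd n. a (n div d) * (b d * of_real (ln (real d)))) / of_real (ln (real n))"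

text \<open>The product of \<open>f\<close> and \<open>- deriv g\<close> is the Dirichlet series
  with coefficients \<open>\<gamma>\<close>. Along the half-line its terms carry the factor
  \<open>n powr (- t)\<close>, and sum and integral may be exchanged because the norms of the terms,
  divided by \<open>ln n\<close>, are summable.\<close>

lemma dirichlet_expansion_volterra:
  assumes "dirichlet_expansion a f" "dirichlet_expansion b g"
  shows "dirichlet_expansion (volterra_coeff b a) (volterra g f)"
proof -
  obtain M1 K1 where a: "M1 \<ge> 0" "K1 \<ge> 0" "\<And>n. n \<ge> 1 \<Longrightarrow> cmod (a n) \<le> M1 * real n powr K1"
    using assms(1) dirichlet_expansion_bound by blast
  obtain M2 K2 where b: "M2 \<ge> 0" "K2 \<ge> 0" "\<And>n. n \<ge> 1 \<Longrightarrow> cmod (b n) \<le> M2 * real n powr K2"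
    using assms(2) dirichlet_expansion_bound by blast
  define \<beta> where "\<beta> d = b d * of_real (ln (real d))" for d
  define \<gamma> where "\<gamma> n = (\<Sum>d | d dvd n. a (n div d) * \<beta> d)" for n
  have \<beta>: "cmod (\<beta> n) \<le> M2 * real n powr (K2 + 1)" if "n \<ge> 1" for n
  proof -
    have "cmod (\<beta> n) \<le> (M2 * real n powr K2) * real n"
      unfolding \<beta>_def norm_mult norm_of_real
      using b that ln_bound[of "real n"] by (intro mult_mono) auto
    then show ?thesis using that by (simp add: powr_add mult_ac)
  qed
  \<comment> \<open>The exponent grows by one for \<open>ln d <= d\<close> and by another one for
    the at most \<open>n\<close> divisors.\<close>
  have \<gamma>: "cmod (\<gamma> n) \<le> (M1 * M2) * real n powr (K1 + K2 + 2)" if n: "n \<ge> 1" for n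
  proof -
    have "cmod (a (n div d) * \<beta> d) \<le> M1 * M2 * real n powr (K1 + K2 + 1)" if d: "d dvd n" for d
    proof -
      have pos: "d \<ge> 1" "n div d \<ge> 1"
        using d n by (auto simp: Suc_le_eq div_greater_zero_iff dvd_imp_le intro!: Nat.gr0I)
      have "cmod (a (n div d)) \<le> M1 * real (n div d) powr K1" using a pos by blast
      also have "\<dots> \<le> M1 * real n powr K1"
        using a pos by (intro mult_left_mono powr_mono2) auto
      finally have 1: "cmod (a (n div d)) \<le> M1 * real n powr K1" .
      have "cmod (\<beta> d) \<le> M2 * real d powr (K2 + 1)" using \<beta> pos by blast
      also have "\<dots> \<le> M2 * real n powr (K2 + 1)"
        using b pos d n by (intro mult_left_mono powr_mono2) (auto dest: dvd_imp_le)
      finally have 2: "cmod (\<beta> d) \<le> M2 * real n powr (K2 + 1)" .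
      have "cmod (a (n div d) * \<beta> d) \<le> (M1 * real n powr K1) * (M2 * real n powr (K2 + 1))"
        unfolding norm_mult using 1 2 a b by (intro mult_mono) auto
      then show ?thesis using n by (simp add: powr_add mult_ac)
    qed
    then have "cmod (\<gamma> n) \<le> real (card {d. d dvd n}) * (M1 * M2 * real n powr (K1 + K2 + 1))"
      unfolding \<gamma>_def by (intro sum_norm_bound) auto
    also have "card {d. d dvd n} \<le> card {1..n}"
      using n by (intro card_mono) (auto dest: dvd_imp_le simp: Suc_le_eq intro!: Nat.gr0I)
    then have "real (card {d. d dvd n}) * (M1 * M2 * real n powr (K1 + K2 + 1))
        \<le> real n * (M1 * M2 * real n powr (K1 + K2 + 1))"
      using a b by (intro mult_right_mono) auto
    finally show ?thesis using n by (simp add: powr_add powr_numeral power2_eq_square mult_ac)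
  qed
  obtain \<theta>1 where \<theta>1: "\<And>s. Re s > \<theta>1 \<Longrightarrow> (\<lambda>n. a (Suc n) / of_nat (Suc n) powr s) sums f s"
    using assms(1) unfolding dirichlet_expansion_def by blast
  obtain \<theta>2 where \<theta>2: "\<And>s. Re s > \<theta>2 \<Longrightarrow> (\<lambda>n. b (Suc n) / of_nat (Suc n) powr s) sums g s"
    using assms(2) unfolding dirichlet_expansion_def by blast
  \<comment> \<open>The third entry is the growth exponent of \<open>\<gamma>\<close> plus 2, enough
    for absolute convergence of all series involved.\<close>
  define \<theta> where "\<theta> = Max {\<theta>1, \<theta>2, K1 + K2 + 4}"
  have \<theta>: "\<theta> \<ge> \<theta>1" "\<theta> \<ge> \<theta>2" "\<theta> \<ge> K1 + K2 + 4" by (auto simp: \<theta>_def)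
  define v where "v s n = \<gamma> n / of_nat n powr s" for s n
  have v_summable: "summable (\<lambda>n. cmod (v s (Suc n)))" if "Re s > \<theta>" for s
    unfolding v_def by (rule norm_summable_dirichlet_term[OF \<gamma>]) (use that \<theta> in auto)
  have v_sums: "(\<lambda>n. v s (Suc n)) sums (- (f s * deriv g s))" if s: "Re s > \<theta>" for s
  proof -
    define F where "F n = a n / of_nat n powr s" for n
    define G where "G n = \<beta> n / of_nat n powr s" for n
    have "(\<lambda>n. F (Suc n)) sums f s"
      unfolding F_def by (rule \<theta>1) (use s \<theta> in auto)
    moreover have "summable (\<lambda>n. norm (F (Suc n)))"
      unfolding F_def by (rule norm_summable_dirichlet_term[OF a(3)]) (use s \<theta> b in auto)
    ultimately have F: "(\<lambda>n. norm (F n)) summable_on {1..}" "(F has_sum f s) {1..}"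
      using norm_summable_sums_imp_has_sum_Suc[of F] by auto
    have "(\<lambda>n. G (Suc n)) sums (- deriv g s)"
      unfolding G_def \<beta>_def
      by (rule deriv_dirichlet[OF b(3), where \<theta> = \<theta>]) (use s \<theta> a \<theta>2 in auto)
    moreover have "summable (\<lambda>n. norm (G (Suc n)))"
      unfolding G_def by (rule norm_summable_dirichlet_term[OF \<beta>]) (use s \<theta> a in auto)
    ultimately have G: "(\<lambda>n. norm (G n)) summable_on {1..}" "(G has_sum (- deriv g s)) {1..}"
      using norm_summable_sums_imp_has_sum_Suc[of G] by auto
    have "((\<lambda>n. \<Sum>d | d dvd n. F (n div d) * G d) has_sum (f s * (- deriv g s))) {1..}"
      using dirichlet_convolution_has_sum[OF F(1) G(1)] F(2) G(2) by (simp add: infsumI)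
    also have "?this \<longleftrightarrow> (v s has_sum (f s * (- deriv g s))) {1..}"
    proof (intro has_sum_cong)
      fix n :: nat assume "n \<in> {1..}"
      then show "(\<Sum>d | d dvd n. F (n div d) * G d) = v s n"
        unfolding v_def \<gamma>_def sum_divide_distrib F_def G_def
        by (intro sum.cong dirichlet_conv_term) auto
    qed
    finally have "((\<lambda>n. v s (Suc n)) has_sum (f s * (- deriv g s))) UNIV"
      by (simp only: has_sum_Suc_iff)
    then show ?thesis by (simp add: has_sum_imp_sums)
  qed
  \<comment> \<open>A nonzero constant term would not be integrable over the half-line; it vanishes
    because \<open>ln 1 = 0\<close>.\<close>
  have \<gamma>1: "\<gamma> (Suc 0) = 0" by (simp add: \<gamma>_def \<beta>_def)
  have "(\<lambda>n. volterra_coeff b a (Suc n) / of_nat (Suc n) powr s) sums volterra g f s" if s: "Re s > \<theta>" for s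
  proof -
    define e :: "nat \<Rightarrow> real \<Rightarrow> real" where "e n t = indicator {0..} t * exp (- (t * ln (real (Suc n))))" for n t
    define \<phi> :: "nat \<Rightarrow> real \<Rightarrow> complex" where "\<phi> n t = v s (Suc n) * of_real (e n t)" for n t
    have e: "has_bochner_integral lborel (e n) (1 / ln (real (Suc n)))" if "n \<noteq> 0" for n
      unfolding e_def by (rule has_bochner_integral_exp_half_line) (use that in simp)
    have \<phi>: "has_bochner_integral lborel (\<phi> n) (v s (Suc n) / of_real (ln (real (Suc n))))" for n
    proof (cases "n = 0")
      case False
      from has_bochner_integral_mult_right[OF has_bochner_integral_of_real[OF e[OF False]], of "v s (Suc n)"]
      show ?thesis unfolding \<phi>_def by simp
    next
      case True
      then have "\<phi> n = (\<lambda>t. 0)" "v s (Suc n) = 0" by (auto simp: \<phi>_def v_def \<gamma>1)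
      then show ?thesis by (simp add: has_bochner_integral_zero)
    qed
    have n\<phi>: "has_bochner_integral lborel (\<lambda>t. cmod (\<phi> n t)) (cmod (v s (Suc n)) / ln (real (Suc n)))" for n
    proof (cases "n = 0")
      case False
      have "cmod (\<phi> n t) = cmod (v s (Suc n)) * e n t" for t
        by (simp add: \<phi>_def norm_mult e_def)
      with has_bochner_integral_mult_right[OF e[OF False], of "cmod (v s (Suc n))"]
      show ?thesis by simp
    qed (simp add: \<phi>_def v_def \<gamma>1 has_bochner_integral_zero)
    have \<phi>_eq: "\<phi> n t = indicator {0..} t *\<^sub>R v (s + of_real t) (Suc n)" for n t
    proof -
      have "of_nat (Suc n) powr (s + of_real t) = of_nat (Suc n) powr s * (exp (of_real (t * ln (real (Suc n)))) :: complex)"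
        by (subst (1 2) of_nat_powr_complex) (auto simp: exp_add[symmetric] ring_distribs)
      moreover have "complex_of_real (exp (- x)) = inverse (exp (of_real x))" for x
        by (simp add: exp_minus exp_of_real)
      ultimately show ?thesis
        unfolding \<phi>_def v_def e_def by (simp add: indicator_def divide_inverse)
    qed
    have \<phi>_sum: "(\<lambda>n. \<phi> n t) sums (- (indicator {0..} t *\<^sub>R (f (s + of_real t) * deriv g (s + of_real t))))" for t
    proof (cases "t \<ge> 0")
      case True
      then show ?thesis using v_sums[of "s + of_real t"] s by (simp add: \<phi>_eq)
    qed (simp add: \<phi>_eq)
    have "(\<lambda>n. integral\<^sup>L lborel (\<phi> n)) sums (\<integral>t. (\<Sum>n. \<phi> n t) \<partial>lborel)"
    proof (rule sums_integral)
      show "integrable lborel (\<phi> n)" for n using \<phi> by (rule integrable.intros)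
      show "AE t in lborel. summable (\<lambda>n. cmod (\<phi> n t))"
      proof (intro AE_I2)
        fix t
        show "summable (\<lambda>n. cmod (\<phi> n t))"
        proof (cases "t \<ge> 0")
          case True
          then show ?thesis using v_summable[of "s + of_real t"] s by (simp add: \<phi>_eq)
        qed (simp add: \<phi>_eq)
      qed
      have "summable (\<lambda>n. 1 / ln 2 * cmod (v s (Suc n)))"
        using v_summable[OF s] by (rule summable_mult)
      then have "summable (\<lambda>n. cmod (v s (Suc n)) / ln (real (Suc n)))"
      proof (rule summable_comparison_test')
        fix n :: nat
        show "norm (cmod (v s (Suc n)) / ln (real (Suc n))) \<le> 1 / ln 2 * cmod (v s (Suc n))"
        proof (cases "n = 0")
          case False
          then have "ln 2 \<le> ln (real (Suc n))" by simp
          then show ?thesis by (auto simp: divide_simps intro!: mult_left_mono)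
        qed simp
      qed
      then show "summable (\<lambda>n. \<integral>t. cmod (\<phi> n t) \<partial>lborel)"
        by (simp only: has_bochner_integral_integral_eq[OF n\<phi>])
    qed
    also have "(\<lambda>n. integral\<^sup>L lborel (\<phi> n)) = (\<lambda>n. volterra_coeff b a (Suc n) / of_nat (Suc n) powr s)"
      by (rule ext) (simp add: has_bochner_integral_integral_eq[OF \<phi>] volterra_coeff_def v_def \<gamma>_def \<beta>_def)
    also have "(\<integral>t. (\<Sum>n. \<phi> n t) \<partial>lborel) = volterra g f s"
      using \<phi>_sum by (simp add: sums_iff volterra_def set_lebesgue_integral_def)
    finally show ?thesis .
  qed
  then show ?thesis unfolding dirichlet_expansion_def by blast
qed

subsection \<open>Sums over primes\<close>

text \<open>From \<open>N\<close> to \<open>Suc N\<close> the quotient \<open>N div d\<close>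
  increases by one exactly for the divisors of \<open>Suc N\<close>, and the von Mangoldt function
  summed over these gives \<open>ln (Suc N)\<close>.\<close>

lemma sum_mangoldt_div:
  "(\<Sum>d\<in>{1..N}. mangoldt d * real (N div d)) = ln (fact N :: real)"
proof (induction N)
  case (Suc N)
  have fin: "{d. d dvd Suc N} \<subseteq> {1..Suc N}" by (auto dest: dvd_imp_le intro!: Suc_leI Nat.gr0I)
  have "(\<Sum>d\<in>{1..Suc N}. mangoldt d * real (Suc N div d))
      = (\<Sum>d\<in>{1..Suc N}. mangoldt d * real (N div d) + (if d dvd Suc N then mangoldt d else 0))"
    by (intro sum.cong refl) (auto simp: div_Suc dvd_eq_mod_eq_0 algebra_simps)
  also have "\<dots> = (\<Sum>d\<in>{1..Suc N}. mangoldt d * real (N div d)) + (\<Sum>d | d dvd Suc N. mangoldt d)"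
    using fin by (simp add: sum.distrib sum.If_cases Int_absorb1 del: sum.cl_ivl_Suc)
  also have "\<dots> = ln (fact N) + ln (real (Suc N))"
    using Suc.IH mangoldt_sum[of "Suc N", where ?'a = real] by simp
  also have "\<dots> = ln (fact (Suc N))" by (simp add: ln_mult)
  finally show ?case .
qed simp

lemma ln_fact_ge: "real N * ln (real N) - real N \<le> ln (fact N)"
proof (induction N)
  case (Suc N)
  have "real N * (ln (real (Suc N)) - ln (real N)) \<le> 1"
  proof (cases "N = 0")
    case False
    then have "ln (real (Suc N)) - ln (real N) = ln (real (Suc N) / real N)"
      by (subst ln_div) auto
    also have "real (Suc N) / real N = 1 + 1 / real N" using False by (simp add: field_simps)
    also have "ln (1 + 1 / real N) \<le> 1 / real N" by (rule ln_add_one_self_le_self) auto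
    finally show ?thesis using False by (simp add: field_simps)
  qed simp
  moreover have "ln (fact (Suc N)) = ln (real (Suc N)) + ln (fact N)" by (simp add: ln_mult)
  ultimately show ?case using Suc.IH by (simp add: algebra_simps)
qed simp

lemma ln_fact_le: "ln (fact N) \<le> real N * ln (real N)"
proof (cases "N = 0")
  case False
  have "(fact N :: real) \<le> real N ^ N" using fact_le_power[of N, where ?'a = real] by simp
  then have "ln (fact N) \<le> ln (real N ^ N)" using False by (subst ln_le_cancel_iff) auto
  then show ?thesis using False by (simp add: ln_realpow)
qed simp

text \<open>
  Restricting to \<open>p \<le> N div m\<close> makes \<open>N div p\<close> at least \<open>m / (m + 1) * (N / p)\<close>, so that no Chebyshev
  bound is needed to remove the rounding.
\<close>

lemma sum_ln_prime_div_le: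
  assumes "m \<ge> 1" "N \<ge> 1"
  shows "(\<Sum>p | prime p \<and> p \<le> N div m. ln (real p) / real p) \<le> (1 + 1 / real m) * ln (real N)"
proof -
  let ?P = "{p. prime p \<and> p \<le> N div m}"
  have "real N * (\<Sum>p\<in>?P. ln (real p) / real p) = (\<Sum>p\<in>?P. ln (real p) * (real N / real p))"
    by (simp add: sum_distrib_left mult_ac)
  also have "\<dots> \<le> (\<Sum>p\<in>?P. ln (real p) * ((1 + 1 / real m) * real (N div p)))"
  proof (intro sum_mono mult_left_mono)
    fix p assume p: "p \<in> ?P"
    then have p2: "p \<ge> 2" by (auto intro: prime_ge_2_nat)
    have "p * m \<le> N"
      using p assms(1) by (metis (mono_tags, lifting) div_times_less_eq_dividend le_trans mem_Collect_eq mult_le_mono1)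
    then have "m \<le> N div p" using p2 by (simp add: less_eq_div_iff_mult_less_eq mult.commute)
    then have "1 \<le> real (N div p) / real m" using assms(1) by simp
    moreover have "N < (N div p + 1) * p" using p2 by (metis Suc_eq_plus1 dividend_less_div_times less_le_trans mult_Suc neq0_conv not_numeral_le_zero)
    then have "real N < (real (N div p) + 1) * real p" by (metis of_nat_1 of_nat_add of_nat_less_iff of_nat_mult)
    then have "real N / real p \<le> real (N div p) + 1" using p2 by (simp add: field_simps)
    ultimately show "real N / real p \<le> (1 + 1 / real m) * real (N div p)" by (simp add: algebra_simps)
    show "0 \<le> ln (real p)" using p2 by simp
  qed
  also have "\<dots> = (1 + 1 / real m) * (\<Sum>p\<in>?P. mangoldt p * real (N div p))"
    by (simp add: sum_distrib_left mult_ac)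
  also have "(\<Sum>p\<in>?P. mangoldt p * real (N div p)) \<le> (\<Sum>d\<in>{1..N}. mangoldt d * real (N div d))"
    by (intro sum_mono2) (auto simp: mangoldt_nonneg prime_gt_0_nat Suc_le_eq intro: order_trans[OF _ div_le_dividend])
  then have "(1 + 1 / real m) * (\<Sum>p\<in>?P. mangoldt p * real (N div p)) \<le> (1 + 1 / real m) * ln (fact N)"
    unfolding sum_mangoldt_div by (intro mult_left_mono) auto
  also have "\<dots> \<le> (1 + 1 / real m) * (real N * ln (real N))"
    by (intro mult_left_mono ln_fact_le) auto
  finally have "real N * (\<Sum>p\<in>?P. ln (real p) / real p) \<le> real N * ((1 + 1 / real m) * ln (real N))"
    by (simp add: algebra_simps)
  then show ?thesis using assms by simp
qed

text \<open>Dropping the rounding in \<open>sum_mangoldt_div\<close> only enlarges the sum. The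
  powers of a prime \<open>p\<close> then form a geometric series, whence the denominator
  \<open>p - 1\<close>.\<close>

lemma ln_le_sum_ln_prime_div:
  assumes "N \<ge> 1"
  shows "ln (real N) - 1 \<le> (\<Sum>p | prime p \<and> p \<le> N. ln (real p) / (real p - 1))"
proof -
  let ?P = "{p. prime p \<and> p \<le> N}"
  have fin: "finite ?P" by (rule finite_subset[of _ "{..N}"]) auto
  have "real N * (ln (real N) - 1) \<le> ln (fact N)" using ln_fact_ge[of N] by (simp add: algebra_simps)
  also have "\<dots> = (\<Sum>d\<in>{1..N}. mangoldt d * real (N div d))" by (rule sum_mangoldt_div[symmetric])
  also have "\<dots> \<le> (\<Sum>d\<in>{1..N}. mangoldt d * (real N / real d))"
    by (intro sum_mono mult_left_mono of_nat_div_le_of_nat mangoldt_nonneg)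
  also have "\<dots> = real N * (\<Sum>d\<in>{1..N}. mangoldt d / real d)"
    by (simp add: sum_distrib_left mult_ac)
  finally have "ln (real N) - 1 \<le> (\<Sum>d\<in>{1..N}. mangoldt d / real d)" using assms by simp
  also have "\<dots> = (\<Sum>d\<in>{d\<in>{1..N}. primepow d}. mangoldt d / real d)"
    by (intro sum.mono_neutral_right) (auto simp: mangoldt_def)
  also have "\<dots> \<le> (\<Sum>(p, k)\<in>?P \<times> {1..N}. ln (real p) * (1 / real p) ^ k)"
  proof (rule sum_le_included[where i = "\<lambda>(p, k). p ^ k"])
    show "\<forall>d\<in>{d \<in> {1..N}. primepow d}. \<exists>y\<in>?P \<times> {1..N}. (case y of (p, k) \<Rightarrow> p ^ k) = d \<and>
        mangoldt d / real d \<le> (case y of (p, k) \<Rightarrow> ln (real p) * (1 / real p) ^ k)"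
    proof
      fix d assume d: "d \<in> {d \<in> {1..N}. primepow d}"
      then obtain p k where pk: "prime p" "k > 0" "d = p ^ k" by (auto simp: primepow_def)
      have "p \<le> p ^ k" using pk by (intro self_le_power) (auto intro: Suc_leI prime_gt_0_nat)
      moreover have "k < p ^ k" using pk prime_gt_1_nat by (intro power_gt_expt) auto
      ultimately have "(p, k) \<in> ?P \<times> {1..N}" using pk d by auto
      moreover have "mangoldt d / real d = ln (real p) * (1 / real p) ^ k"
        using pk by (simp add: power_divide)
      ultimately show "\<exists>y\<in>?P \<times> {1..N}. (case y of (p, k) \<Rightarrow> p ^ k) = d \<and>
          mangoldt d / real d \<le> (case y of (p, k) \<Rightarrow> ln (real p) * (1 / real p) ^ k)"
        using pk by (intro bexI[of _ "(p, k)"]) auto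
    qed
  qed (use fin in \<open>auto intro!: mult_nonneg_nonneg ln_ge_zero dest: prime_ge_1_nat\<close>)
  also have "\<dots> = (\<Sum>p\<in>?P. ln (real p) * (\<Sum>k=1..N. (1 / real p) ^ k))"
    by (simp add: sum.cartesian_product[symmetric] sum_distrib_left)
  also have "\<dots> \<le> (\<Sum>p\<in>?P. ln (real p) * (1 / (real p - 1)))"
  proof (intro sum_mono mult_left_mono)
    fix p assume "p \<in> ?P"
    then have p: "real p \<ge> 2" using prime_ge_2_nat[of p] by auto
    have "(\<Sum>k=1..N. (1 / real p) ^ k) = (1 / real p - (1 / real p) ^ Suc N) / (1 - 1 / real p)"
      using p by (subst sum_gp) (auto simp: field_simps)
    also have "\<dots> \<le> (1 / real p) / (1 - 1 / real p)" using p by (intro divide_right_mono) auto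
    also have "\<dots> = 1 / (real p - 1)" using p by (simp add: field_simps)
    finally show "(\<Sum>k=1..N. (1 / real p) ^ k) \<le> 1 / (real p - 1)" .
    show "0 \<le> ln (real p)" using p by simp
  qed
  finally show ?thesis by simp
qed

text \<open>Replacing \<open>p - 1\<close> by \<open>p\<close> changes each term by
  \<open>ln p / (p * (p - 1))\<close>, which is summable even over all integers.\<close>

lemma mertens_lower_bound:
  obtains B where "\<And>N. N \<ge> 1 \<Longrightarrow> ln (real N) - B \<le> (\<Sum>p | prime p \<and> p \<le> N. ln (real p) / real p)"
proof -
  define u where "u = (\<lambda>n. ln (real n) / (real n * (real n - 1)))"
  have "u \<in> O(\<lambda>n. real n powr (-3/2))" unfolding u_def by real_asymp
  moreover have "summable (\<lambda>n. norm (real n powr (-3/2)))"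
    using summable_real_powr_iff[of "-3/2"] by simp
  ultimately have u: "summable u" by (rule summable_comparison_test_bigo[rotated])
  have u0: "u n \<ge> 0" for n by (cases "n = 0") (auto simp: u_def)
  show ?thesis
  proof (rule that[of "1 + suminf u"])
    fix N :: nat assume N: "N \<ge> 1"
    let ?P = "{p. prime p \<and> p \<le> N}"
    have fin: "finite ?P" by (rule finite_subset[of _ "{..N}"]) auto
    have "ln (real N) - 1 \<le> (\<Sum>p\<in>?P. ln (real p) / (real p - 1))" using N by (rule ln_le_sum_ln_prime_div)
    also have "\<dots> = (\<Sum>p\<in>?P. ln (real p) / real p + u p)"
    proof (intro sum.cong refl)
      fix p assume "p \<in> ?P"
      then have "real p \<ge> 2" using prime_ge_2_nat[of p] by auto
      then show "ln (real p) / (real p - 1) = ln (real p) / real p + u p"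
        by (simp add: u_def field_simps)
    qed
    also have "\<dots> = (\<Sum>p\<in>?P. ln (real p) / real p) + sum u ?P" by (rule sum.distrib)
    also have "sum u ?P \<le> suminf u" using u u0 fin by (intro sum_le_suminf) auto
    finally show "ln (real N) - (1 + suminf u) \<le> (\<Sum>p\<in>?P. ln (real p) / real p)" by linarith
  qed
qed

section \<open>Sums of reciprocals of primes\<close>

lemma finite_primes_le_real [simp]: "finite {p. prime p \<and> real p \<le> x}"
proof (rule finite_subset)
  show "{p. prime p \<and> real p \<le> x} \<subseteq> {..nat \<lfloor>x\<rfloor>}" by (auto simp: le_nat_floor)
qed simp

text \<open>For primes between \<open>exp (2 ^ i)\<close> and its square, \<open>1 / p\<close> is at
  most \<open>(ln p / p) / 2 ^ i\<close>. The bound with \<open>m = 1\<close> limits such a window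
  to \<open>2 * 2 ^ Suc i / 2 ^ i = 4\<close>. In the base case 2 is the only prime below
  \<open>exp 1\<close>.\<close>

lemma sum_inverse_primes_double_exp:
  "(\<Sum>p | prime p \<and> real p \<le> exp (2 ^ i). 1 / real p) \<le> 4 * real i + 1"
proof (induction i)
  case 0
  have "{p::nat. prime p \<and> real p \<le> exp 1} \<subseteq> {2}"
  proof clarify
    fix p :: nat assume p: "prime p" "real p \<le> exp 1"
    then have "real p < 3" using exp_le e_less_272 by linarith
    then show "p = 2" using prime_ge_2_nat[OF p(1)] by simp
  qed
  then have "(\<Sum>p | prime p \<and> real p \<le> exp 1. 1 / real p) \<le> (\<Sum>p\<in>{2}. 1 / real p)"
    by (intro sum_mono2) auto
  then show ?case by simp
next
  case (Suc i)
  define x :: real where "x = exp (2 ^ i)"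
  define y :: real where "y = exp (2 ^ Suc i)"
  define N where "N = nat \<lfloor>y\<rfloor>"
  have y1: "y \<ge> 1" by (simp add: y_def)
  then have N: "N \<ge> 1" "real N \<le> y" by (auto simp: N_def le_nat_floor intro: of_nat_floor)
  have xy: "x \<le> y" by (simp add: x_def y_def)
  have "(\<Sum>p | prime p \<and> real p \<le> y. 1 / real p)
      = (\<Sum>p | prime p \<and> real p \<le> x. 1 / real p) + (\<Sum>p | prime p \<and> x < real p \<and> real p \<le> y. 1 / real p)"
    using xy by (subst sum.union_disjoint[symmetric]) (auto intro!: sum.cong intro: finite_subset[OF _ finite_primes_le_real[of y]])
  moreover have "(\<Sum>p | prime p \<and> x < real p \<and> real p \<le> y. 1 / real p)
      \<le> (\<Sum>p | prime p \<and> x < real p \<and> real p \<le> y. (ln (real p) / real p) / 2 ^ i)"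
  proof (intro sum_mono)
    fix p assume p: "p \<in> {p. prime p \<and> x < real p \<and> real p \<le> y}"
    then have p0: "real p > 0" using prime_gt_0_nat[of p] by simp
    have "ln x < ln (real p)" using p p0 by (subst ln_less_cancel_iff) (auto simp: x_def)
    then have "2 ^ i \<le> ln (real p)" by (simp add: x_def)
    with p0 show "1 / real p \<le> (ln (real p) / real p) / 2 ^ i" by (simp add: field_simps)
  qed
  moreover have "\<dots> \<le> (\<Sum>p | prime p \<and> p \<le> N div 1. (ln (real p) / real p) / 2 ^ i)"
    by (intro sum_mono2) (auto simp: N_def le_nat_floor intro!: divide_nonneg_nonneg ln_ge_zero dest: prime_ge_1_nat)
  moreover have "\<dots> = (\<Sum>p | prime p \<and> p \<le> N div 1. ln (real p) / real p) / 2 ^ i"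
    by (simp add: sum_divide_distrib)
  moreover have "\<dots> \<le> ((1 + 1 / real 1) * ln (real N)) / 2 ^ i"
    using N by (intro divide_right_mono sum_ln_prime_div_le) auto
  moreover have "\<dots> \<le> 4"
  proof -
    have "ln (real N) \<le> ln y" using N by (subst ln_le_cancel_iff) auto
    then show ?thesis by (simp add: y_def field_simps)
  qed
  ultimately show ?case using Suc.IH unfolding x_def y_def by simp
qed

text \<open>Round \<open>ln y\<close> up to a power of 2. The constant doubles from 4 to 8 through
  \<open>1 / ln 2 <= 2\<close>; any constant would do, since the Rankin error only has to be
  \<open>o(S)\<close>.\<close>

lemma sum_inverse_primes_le:
  assumes "y \<ge> exp 1"
  shows "(\<Sum>p | prime p \<and> real p \<le> y. 1 / real p) \<le> 8 * ln (ln y) + 5"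
proof -
  have y: "y > 0" using assms less_le_trans[OF exp_gt_zero] by blast
  have Y: "ln y \<ge> 1" using assms y by (simp add: ln_ge_iff)
  define i where "i = nat \<lceil>log 2 (ln y)\<rceil>"
  have l0: "log 2 (ln y) \<ge> 0" using Y by simp
  have i: "log 2 (ln y) \<le> real i" "real i \<le> log 2 (ln y) + 1" using l0 by (auto simp: i_def)
  have "ln y = 2 powr log 2 (ln y)" using Y by simp
  also have "\<dots> \<le> 2 powr real i" using i by (intro powr_mono) auto
  finally have "ln y \<le> 2 ^ i" by (simp add: powr_realpow)
  then have "y \<le> exp (2 ^ i)" using y by (metis exp_le_cancel_iff exp_ln)
  then have "(\<Sum>p | prime p \<and> real p \<le> y. 1 / real p) \<le> (\<Sum>p | prime p \<and> real p \<le> exp (2 ^ i). 1 / real p)"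
    by (intro sum_mono2) auto
  also have "\<dots> \<le> 4 * real i + 1" by (rule sum_inverse_primes_double_exp)
  also have "\<dots> \<le> 4 * log 2 (ln y) + 5" using i by linarith
  also have "log 2 (ln y) \<le> 2 * ln (ln y)"
  proof -
    have "1 / 2 \<le> ln (2::real)" using ln2_ge_two_thirds by simp
    then have "1 / ln (2::real) \<le> 2" by (simp add: field_simps)
    then show ?thesis using Y mult_right_mono[of "1 / ln 2" 2 "ln (ln y)"] by (simp add: log_def)
  qed
  finally show ?thesis by linarith
qed

subsection \<open>Weighted divisor sums\<close>

text \<open>An Euler product bound, by splitting off the full power of one prime at a time. Each
  local factor is at most \<open>1 / (1 - x) <= exp (x / (1 - x)) <= exp (4 * x)\<close> for
  \<open>x = h p\<close>, where the last step uses \<open>x <= 3 / 4\<close>.\<close>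

lemma sum_divisors_le_exp:
  fixes h :: "nat \<Rightarrow> real"
  assumes one: "h 1 = 1" and mult: "\<And>m n. h (m * n) = h m * h n" and nonneg: "\<And>n. h n \<ge> 0"
    and prime: "\<And>p. prime p \<Longrightarrow> h p \<le> 3 / 4" and n: "n \<ge> 1"
  shows "(\<Sum>d | d dvd n. h d) \<le> exp (4 * (\<Sum>p\<in>prime_factors n. h p))"
  using n
proof (induction n rule: less_induct)
  case (less n)
  show ?case
  proof (cases "n = 1")
    case False
    then obtain p where p: "prime p" "p dvd n" using prime_factor_nat by blast
    define k where "k = multiplicity p n"
    obtain m where m: "n = p ^ k * m" "\<not> p dvd m"
      using multiplicity_decompose'[of n p] p less.prems unfolding k_def
      by (metis not_one_le_zero not_prime_unit)
    have k: "k > 0" using p less.prems unfolding k_def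
      by (subst prime_multiplicity_gt_zero_iff) auto
    have "m \<noteq> 0" using m less.prems by (cases m) auto
    have "p ^ k > 1" using k prime_gt_1_nat[OF p(1)] by (intro one_less_power)
    then have "m < n" using m \<open>m \<noteq> 0\<close> by simp
    have IH: "(\<Sum>d | d dvd m. h d) \<le> exp (4 * (\<Sum>p\<in>prime_factors m. h p))"
      using less.IH[OF \<open>m < n\<close>] \<open>m \<noteq> 0\<close> by simp
    have hpow: "h (p ^ i) = h p ^ i" for i by (induction i) (use one mult in auto)
    have "(\<Sum>d | d dvd n. h d) \<le> (\<Sum>(i, e)\<in>{..k} \<times> {e. e dvd m}. h p ^ i * h e)"
    proof (rule sum_le_included[where i = "\<lambda>(i, e). p ^ i * e"])
      show "finite {d. d dvd n}" using less.prems by simp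
      show "finite ({..k} \<times> {e. e dvd m})" using \<open>m \<noteq> 0\<close> by simp
      show "\<forall>y\<in>{..k} \<times> {e. e dvd m}. 0 \<le> (case y of (i, e) \<Rightarrow> h p ^ i * h e)"
        using nonneg by auto
      show "\<forall>d\<in>{d. d dvd n}. \<exists>y\<in>{..k} \<times> {e. e dvd m}. (case y of (i, e) \<Rightarrow> p ^ i * e) = d \<and>
          h d \<le> (case y of (i, e) \<Rightarrow> h p ^ i * h e)"
      proof
        fix d assume "d \<in> {d. d dvd n}"
        then obtain u e where ue: "d = u * e" "u dvd p ^ k" "e dvd m"
          using m by (metis dvd_productE mem_Collect_eq)
        then obtain i where i: "i \<le> k" "u = p ^ i" using p divides_primepow_nat by blast
        show "\<exists>y\<in>{..k} \<times> {e. e dvd m}. (case y of (i, e) \<Rightarrow> p ^ i * e) = d \<and>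
            h d \<le> (case y of (i, e) \<Rightarrow> h p ^ i * h e)"
          using ue i by (intro bexI[of _ "(i, e)"]) (auto simp: mult hpow)
      qed
    qed
    also have "\<dots> = (\<Sum>i\<le>k. h p ^ i) * (\<Sum>d | d dvd m. h d)"
      by (simp add: sum.cartesian_product[symmetric] sum_product)
    also have "\<dots> \<le> exp (4 * h p) * exp (4 * (\<Sum>p\<in>prime_factors m. h p))"
    proof (intro mult_mono IH)
      define x where "x = h p"
      have x: "0 \<le> x" "x \<le> 3 / 4" using nonneg prime p by (auto simp: x_def)
      have "(\<Sum>i\<le>k. x ^ i) = (1 - x ^ Suc k) / (1 - x)"
        using x by (subst sum_gp0) auto
      also have "\<dots> \<le> 1 / (1 - x)" using x by (intro divide_right_mono) auto
      also have "\<dots> = 1 + x / (1 - x)" using x by (simp add: field_simps)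
      also have "\<dots> \<le> exp (x / (1 - x))" by (rule exp_ge_add_one_self)
      also have "x / (1 - x) \<le> 4 * x"
      proof -
        have "x * 1 \<le> x * (4 * (1 - x))" using x by (intro mult_left_mono) auto
        then show ?thesis using x by (simp add: field_simps)
      qed
      finally show "(\<Sum>i\<le>k. h p ^ i) \<le> exp (4 * h p)" by (simp add: x_def)
    qed (use nonneg in \<open>auto intro: sum_nonneg\<close>)
    also have "\<dots> = exp (4 * (\<Sum>p\<in>insert p (prime_factors m). h p))"
      using m by (subst sum.insert) (auto simp: exp_add[symmetric] distrib_left)
    also have "insert p (prime_factors m) = prime_factors n"
      using m \<open>m \<noteq> 0\<close> k p by (auto simp: prime_factors_product prime_factorization_prime_power)
    finally show ?thesis .
  qed (use one in simp)
qed

text \<open>Split at \<open>y = ln n\<close>. For \<open>p <= y\<close> bound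
  \<open>p powr \<sigma>\<close> by \<open>y powr \<sigma>\<close> and use the sum of reciprocals of
  primes. Of larger prime factors there are at most \<open>2 * y\<close>, each contributing at most
  \<open>y powr (\<sigma> - 1)\<close>.\<close>

lemma sum_prime_factors_powr_le:
  assumes \<sigma>: "0 \<le> \<sigma>" "\<sigma> \<le> 1 / 2" and n: "exp (exp 1) \<le> real n"
  shows "(\<Sum>p\<in>prime_factors n. real p powr (\<sigma> - 1)) \<le> ln (real n) powr \<sigma> * (8 * ln (ln (ln (real n))) + 7)"
proof -
  define y where "y = ln (real n)"
  have n0: "real n > 0" using n less_le_trans[OF exp_gt_zero] by blast
  have y: "y \<ge> exp 1" using n n0 unfolding y_def by (simp add: ln_ge_iff)
  then have y0: "y > 0" using less_le_trans[OF exp_gt_zero] by blast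
  let ?A = "{p\<in>prime_factors n. real p \<le> y}" and ?B = "{p\<in>prime_factors n. \<not> real p \<le> y}"
  have "(\<Sum>p\<in>prime_factors n. real p powr (\<sigma> - 1)) =
      (\<Sum>p\<in>?A. real p powr (\<sigma> - 1)) + (\<Sum>p\<in>?B. real p powr (\<sigma> - 1))"
    by (subst sum.union_disjoint[symmetric]) (auto intro!: sum.cong)
  moreover have "(\<Sum>p\<in>?A. real p powr (\<sigma> - 1)) \<le> y powr \<sigma> * (8 * ln (ln y) + 5)"
  proof -
    have "(\<Sum>p\<in>?A. real p powr (\<sigma> - 1)) \<le> (\<Sum>p\<in>?A. y powr \<sigma> * (1 / real p))"
    proof (intro sum_mono)
      fix p assume "p \<in> ?A"
      then have p: "real p > 0" "real p \<le> y" by (auto intro: Nat.gr0I)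
      have "real p powr (\<sigma> - 1) = real p powr \<sigma> * (1 / real p)"
        using p by (simp add: powr_diff)
      also have "\<dots> \<le> y powr \<sigma> * (1 / real p)"
        using p \<sigma> by (intro mult_right_mono powr_mono2) auto
      finally show "real p powr (\<sigma> - 1) \<le> y powr \<sigma> * (1 / real p)" .
    qed
    also have "\<dots> = y powr \<sigma> * (\<Sum>p\<in>?A. 1 / real p)" by (simp add: sum_distrib_left)
    also have "(\<Sum>p\<in>?A. 1 / real p) \<le> (\<Sum>p | prime p \<and> real p \<le> y. 1 / real p)"
      by (intro sum_mono2) auto
    also have "\<dots> \<le> 8 * ln (ln y) + 5" using y by (rule sum_inverse_primes_le)
    finally show ?thesis by (simp add: mult_left_mono)
  qed
  moreover have "(\<Sum>p\<in>?B. real p powr (\<sigma> - 1)) \<le> y powr \<sigma> * 2"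
  proof -
    \<comment> \<open>Every prime factor is at least 2, so 2 to the number of distinct prime factors
      is at most \<open>n\<close>.\<close>
    have "real (card (prime_factors n)) * ln 2 \<le> y"
    proof -
      have "2 ^ card (prime_factors n) = (\<Prod>p\<in>prime_factors n. 2 :: nat)" by simp
      also have "\<dots> \<le> (\<Prod>p\<in>prime_factors n. p ^ multiplicity p n)"
      proof (intro prod_mono conjI)
        fix p assume p: "p \<in> prime_factors n"
        then have "p ^ 1 \<le> p ^ multiplicity p n"
          by (intro power_increasing) (auto simp: prime_factors_multiplicity dest: prime_gt_0_nat)
        then show "2 \<le> p ^ multiplicity p n" using prime_ge_2_nat[of p] in_prime_factors_imp_prime[OF p] by auto
      qed auto
      also have "\<dots> = n" using n0 by (intro prime_factorization_nat[symmetric]) simp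
      finally have "2 ^ card (prime_factors n) \<le> n" .
      then have "(2::real) ^ card (prime_factors n) \<le> real n"
        by (metis of_nat_le_iff of_nat_numeral of_nat_power)
      then have "ln ((2::real) ^ card (prime_factors n)) \<le> y"
        unfolding y_def using n0 by (subst ln_le_cancel_iff) auto
      then show ?thesis by (simp add: ln_realpow)
    qed
    moreover have "real (card (prime_factors n)) * (1 / 2) \<le> real (card (prime_factors n)) * ln 2"
      using ln2_ge_two_thirds by (intro mult_left_mono) auto
    moreover have "card ?B \<le> card (prime_factors n)" by (intro card_mono) auto
    ultimately have card: "real (card ?B) \<le> 2 * y" by simp
    have "(\<Sum>p\<in>?B. real p powr (\<sigma> - 1)) \<le> (\<Sum>p\<in>?B. y powr (\<sigma> - 1))"
      using y0 \<sigma> by (intro sum_mono powr_mono2') auto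
    also have "\<dots> = real (card ?B) * y powr (\<sigma> - 1)" by simp
    also have "\<dots> \<le> (2 * y) * y powr (\<sigma> - 1)" using card by (intro mult_right_mono) auto
    also have "\<dots> = y powr \<sigma> * 2" using y0 by (simp add: powr_diff)
    finally show ?thesis .
  qed
  ultimately show ?thesis by (simp add: y_def algebra_simps)
qed

text \<open>The condition \<open>\<sigma> <= 1 / 2\<close> keeps
  \<open>p powr (\<sigma> - 1)\<close> below \<open>1 / sqrt 2\<close>, hence below the
  \<open>3 / 4\<close> of the Euler product bound.\<close>

lemma sum_divisors_powr_le:
  assumes \<sigma>: "0 \<le> \<sigma>" "\<sigma> \<le> 1 / 2" and n: "exp (exp 1) \<le> real n"
  shows "(\<Sum>d | d dvd n. real d powr (\<sigma> - 1))
           \<le> exp (4 * (ln (real n) powr \<sigma> * (8 * ln (ln (ln (real n))) + 7)))"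
proof -
  have n0: "n \<ge> 1" using n less_le_trans[OF exp_gt_zero, of "exp 1" "real n"] by (cases n) auto
  have "(\<Sum>d | d dvd n. real d powr (\<sigma> - 1)) \<le> exp (4 * (\<Sum>p\<in>prime_factors n. real p powr (\<sigma> - 1)))"
  proof (rule sum_divisors_le_exp)
    fix p :: nat assume p: "prime p"
    have "real p powr (\<sigma> - 1) \<le> real p powr (- (1 / 2))"
      using \<sigma> prime_ge_1_nat[OF p] by (intro powr_mono) auto
    also have "\<dots> \<le> 2 powr (- (1 / 2))"
      using prime_ge_2_nat[OF p] by (intro powr_mono2') auto
    also have "\<dots> = 1 / sqrt 2" by (simp only: powr_minus_divide) (simp add: powr_half_sqrt)
    also have "\<dots> \<le> 3 / 4"
    proof -
      have "4 / 3 \<le> sqrt 2" by (rule real_le_rsqrt) (simp add: power2_eq_square)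
      then show ?thesis by (simp add: field_simps)
    qed
    finally show "real p powr (\<sigma> - 1) \<le> 3 / 4" .
  qed (use n0 in \<open>auto simp: powr_mult\<close>)
  also have "\<dots> \<le> exp (4 * (ln (real n) powr \<sigma> * (8 * ln (ln (ln (real n))) + 7)))"
    using sum_prime_factors_powr_le[OF assms] by simp
  finally show ?thesis .
qed

section \<open>Rankin's method on logarithmic blocks of divisors\<close>

definition divisor_block :: "nat \<Rightarrow> nat \<Rightarrow> nat set" where
  "divisor_block n j = {d. d dvd n \<and> nat \<lfloor>ln (real d)\<rfloor> = j}"

lemma divisor_blockD:
  assumes "d \<in> divisor_block n j" "n \<ge> 1"
  shows "d \<ge> 1" "d dvd n" "exp (real j) \<le> real d" "real d < exp (real j + 1)"
proof -
  have d: "d dvd n" "nat \<lfloor>ln (real d)\<rfloor> = j" using assms by (auto simp: divisor_block_def)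
  show "d dvd n" by fact
  show 1: "d \<ge> 1" using d assms(2) by (cases d) auto
  then have "ln (real d) \<ge> 0" by simp
  with d(2) have "real j \<le> ln (real d)" "ln (real d) < real j + 1" by linarith+
  with 1 show "exp (real j) \<le> real d" "real d < exp (real j + 1)"
    by (metis exp_le_cancel_iff exp_ln of_nat_0_less_iff less_eq_Suc_le One_nat_def)
      (metis 1 \<open>ln (real d) < real j + 1\<close> exp_less_cancel_iff exp_ln of_nat_0_less_iff less_eq_Suc_le One_nat_def)
qed

lemma finite_divisor_block: "n \<ge> 1 \<Longrightarrow> finite (divisor_block n j)"
  unfolding divisor_block_def by (rule finite_subset[of _ "{d. d dvd n}"]) auto

text \<open>This ignores divisibility: at most \<open>exp (j + 1)\<close> integers lie in the block,
  each with reciprocal at most \<open>exp (- j)\<close>.\<close>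

lemma sum_divisor_block_le_3:
  assumes "n \<ge> 1"
  shows "(\<Sum>d\<in>divisor_block n j. 1 / real d) \<le> 3"
proof -
  have "divisor_block n j \<subseteq> {1..nat \<lfloor>exp (real j + 1)\<rfloor>}"
    using divisor_blockD[OF _ assms] by (force simp: le_nat_floor)
  then have "card (divisor_block n j) \<le> nat \<lfloor>exp (real j + 1)\<rfloor>"
    using card_mono[of "{1..nat \<lfloor>exp (real j + 1)\<rfloor>}" "divisor_block n j"] by simp
  then have card: "real (card (divisor_block n j)) \<le> exp (real j + 1)"
    using of_nat_floor[of "exp (real j + 1)"] by (smt (verit) exp_ge_zero of_nat_le_iff)
  have "(\<Sum>d\<in>divisor_block n j. 1 / real d) \<le> (\<Sum>d\<in>divisor_block n j. exp (- real j))"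
  proof (intro sum_mono)
    fix d assume "d \<in> divisor_block n j"
    then have "exp (real j) \<le> real d" using divisor_blockD assms by blast
    then show "1 / real d \<le> exp (- real j)"
      using frac_le[of 1 1 "exp (real j)" "real d"] by (simp add: exp_minus divide_inverse)
  qed
  also have "\<dots> = real (card (divisor_block n j)) * exp (- real j)" by simp
  also have "\<dots> \<le> exp (real j + 1) * exp (- real j)" using card by (intro mult_right_mono) auto
  also have "\<dots> = exp 1" by (simp add: exp_add[symmetric])
  also have "\<dots> \<le> 3" by (rule exp_le)
  finally show ?thesis .
qed

text \<open>Rankin's trick: on the block \<open>d / exp j >= 1\<close>, so each term may be
  multiplied by the power \<open>\<sigma>\<close> of this quotient before extending the sum to all
  divisors.\<close>

lemma sum_divisor_block_rankin:
  assumes "n \<ge> 1" "\<sigma> \<ge> 0"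
  shows "(\<Sum>d\<in>divisor_block n j. 1 / real d) \<le> exp (- (\<sigma> * real j)) * (\<Sum>d | d dvd n. real d powr (\<sigma> - 1))"
proof -
  have "(\<Sum>d\<in>divisor_block n j. 1 / real d) \<le> (\<Sum>d\<in>divisor_block n j. exp (- (\<sigma> * real j)) * real d powr (\<sigma> - 1))"
  proof (intro sum_mono)
    fix d assume d: "d \<in> divisor_block n j"
    have d1: "d \<ge> 1" "exp (real j) \<le> real d" using divisor_blockD[OF d assms(1)] by auto
    have "exp (real j) powr \<sigma> \<le> real d powr \<sigma>" using d1 assms by (intro powr_mono2) auto
    then have "exp (\<sigma> * real j) \<le> real d powr \<sigma>" by (simp add: powr_def mult.commute)
    then show "1 / real d \<le> exp (- (\<sigma> * real j)) * real d powr (\<sigma> - 1)"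
      using d1 by (simp add: powr_diff exp_minus field_simps)
  qed
  also have "\<dots> \<le> exp (- (\<sigma> * real j)) * (\<Sum>d | d dvd n. real d powr (\<sigma> - 1))"
    unfolding sum_distrib_left[symmetric] using assms
    by (intro mult_left_mono sum_mono2) (auto simp: divisor_block_def)
  finally show ?thesis .
qed

text \<open>Here \<open>\<tau> < 1 / 2\<close> is decisive: it makes
  \<open>j powr \<tau> * ln j\<close> of smaller order than \<open>sqrt (j * ln j)\<close>.\<close>

lemma rankin_error_eventually:
  assumes "\<tau> < 1 / 2" "\<delta> > 0"
  shows "\<forall>\<^sub>F j :: nat in sequentially.
    4 * (real j powr \<tau> * (8 * ln (real j) + 7)) \<le> \<delta> * sqrt (real j * ln (real j))"
  using assms by real_asymp

lemma sqrt_mult_ln_le: "sqrt (real j * ln (real j)) \<le> real j"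
proof -
  have "real j * ln (real j) \<le> real j * real j"
    by (cases "j = 0") (auto intro!: mult_left_mono ln_bound)
  then show ?thesis by (simp add: real_le_lsqrt power2_eq_square)
qed

text \<open>
  Rankin's exponent \<open>\<sigma>\<close> is chosen such that \<open>ln n powr \<sigma> = j powr \<tau>\<close>, which is \<open>o(S)\<close> even after
  multiplication by the prime sum.  If \<open>Y \<ge> S\<close>, the factor \<open>(ln n)\<^sup>2\<close> alone suffices.
\<close>

lemma divisor_block_large:
  fixes \<tau> \<kappa> :: real
  assumes \<tau>: "0 < \<tau>" "\<tau> < 1 / 2" and \<kappa>: "\<kappa> \<le> 2 * sqrt (2 * \<tau>)"
    and j: "real j \<ge> 16"
    and err: "4 * (real j powr \<tau> * (8 * ln (real j) + 7)) \<le> (2 * sqrt (2 * \<tau>) - \<kappa>) * sqrt (real j * ln (real j))"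
    and n: "n \<ge> 1" "real j \<le> ln (real n)"
  shows "(\<Sum>d\<in>divisor_block n j. 1 / real d) \<le> 3 * (ln (real n))\<^sup>2 * exp (- \<kappa> * sqrt (real j * ln (real j)))"
proof -
  define S where "S = sqrt (real j * ln (real j))"
  define Y where "Y = ln (ln (real n))"
  have "exp 1 < (16 :: real)" using e_less_272 by simp
  then have j_ge_e: "exp 1 \<le> real j" using j by linarith
  then have lnj: "ln (real j) \<ge> 1" using j by (simp add: ln_ge_iff)
  have lnn: "ln (real n) \<ge> exp 1" "ln (real n) > 0" using n(2) j_ge_e j by linarith+
  have n_ge: "exp (exp 1) \<le> real n" using lnn n(1) by (simp add: ln_ge_iff)
  have Yj: "ln (real j) \<le> Y" unfolding Y_def using n(2) j by (subst ln_le_cancel_iff) auto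
  then have Y1: "Y \<ge> 1" using lnj by linarith
  have S0: "S > 0" using j lnj by (simp add: S_def)
  have S2: "S\<^sup>2 = real j * ln (real j)" using j lnj by (simp add: S_def)
  have sq: "(ln (real n))\<^sup>2 = exp (2 * Y)" using lnn by (simp add: Y_def exp_double)
  have "(\<Sum>d\<in>divisor_block n j. 1 / real d) \<le> 3 * exp (2 * Y - \<kappa> * S)"
  proof (cases "Y \<ge> S")
    case True
    have "sqrt (2 * \<tau>) \<le> 1" using \<tau> by simp
    then have "\<kappa> \<le> 2" using \<kappa> by linarith
    then have "\<kappa> * S \<le> 2 * S" using S0 by (intro mult_right_mono) auto
    then have "1 \<le> exp (2 * Y - \<kappa> * S)" using True by simp
    then show ?thesis using sum_divisor_block_le_3[OF n(1), of j] by linarith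
  next
    case False
    define \<sigma> where "\<sigma> = \<tau> * ln (real j) / Y"
    have "\<sigma> \<le> \<tau> * 1" unfolding \<sigma>_def times_divide_eq_right[symmetric]
      using \<tau> Yj Y1 by (intro mult_left_mono) auto
    moreover have "0 \<le> \<sigma>" using \<tau> lnj Y1 by (simp add: \<sigma>_def)
    ultimately have \<sigma>: "0 \<le> \<sigma>" "\<sigma> \<le> 1 / 2" using \<tau> by auto
    have pow: "ln (real n) powr \<sigma> = real j powr \<tau>"
      using lnn j Y1 by (simp add: powr_def \<sigma>_def Y_def[symmetric])
    \<comment> \<open>In this case \<open>Y < S <= j\<close>, so the triple logarithm of
      \<open>n\<close> in the prime sum can be replaced by \<open>ln j\<close>.\<close>
    have "ln Y \<le> ln (real j)"
    proof -
      have "Y \<le> real j" using False sqrt_mult_ln_le[of j] by (simp add: S_def)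
      then show ?thesis using Y1 j by (subst ln_le_cancel_iff) auto
    qed
    then have err': "4 * (real j powr \<tau> * (8 * ln Y + 7)) \<le> (2 * sqrt (2 * \<tau>) - \<kappa>) * S"
      using err unfolding S_def
      by (intro order_trans[OF _ err]) (auto intro!: mult_left_mono)
    \<comment> \<open>Completing the square, with equality at
      \<open>sqrt \<tau> * S = sqrt 2 * Y\<close>: this is the critical size of \<open>n\<close> for
      given \<open>j\<close>, and it determines the admissible \<open>\<kappa>\<close>.\<close>
    have amgm: "2 * sqrt (2 * \<tau>) * S \<le> \<sigma> * real j + 2 * Y"
    proof -
      have "0 \<le> (sqrt \<tau> * S - sqrt 2 * Y)\<^sup>2" by simp
      also have "\<dots> = \<tau> * S\<^sup>2 + 2 * Y\<^sup>2 - 2 * sqrt (2 * \<tau>) * S * Y"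
        using \<tau> by (simp add: power2_diff power_mult_distrib real_sqrt_mult)
      also have "\<tau> * S\<^sup>2 = \<sigma> * real j * Y" using Y1 by (simp add: S2 \<sigma>_def)
      finally have "(2 * sqrt (2 * \<tau>) * S) * Y \<le> (\<sigma> * real j + 2 * Y) * Y"
        by (simp add: algebra_simps power2_eq_square)
      then show ?thesis using Y1 by simp
    qed
    have "(\<Sum>d\<in>divisor_block n j. 1 / real d)
        \<le> exp (- (\<sigma> * real j)) * (\<Sum>d | d dvd n. real d powr (\<sigma> - 1))"
      using n(1) \<sigma>(1) by (rule sum_divisor_block_rankin)
    also have "\<dots> \<le> exp (- (\<sigma> * real j)) * exp (4 * (ln (real n) powr \<sigma> * (8 * ln (ln (ln (real n))) + 7)))"
      by (intro mult_left_mono sum_divisors_powr_le \<sigma> n_ge) auto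
    also have "\<dots> = exp (4 * (real j powr \<tau> * (8 * ln Y + 7)) - \<sigma> * real j)"
      by (simp add: pow Y_def exp_add[symmetric])
    also have "\<dots> \<le> exp (2 * Y - \<kappa> * S)"
      using err' amgm by (simp add: algebra_simps)
    also have "\<dots> \<le> 3 * exp (2 * Y - \<kappa> * S)" by simp
    finally show ?thesis .
  qed
  then show ?thesis by (simp add: sq S_def exp_diff exp_minus divide_inverse)
qed

text \<open>Three ranges of \<open>j\<close>: the trivial bound 3 for \<open>j < J\<close>, Rankin's
  bound for \<open>J <= j <= ln n\<close>, and empty blocks beyond \<open>ln n\<close>.\<close>

lemma divisor_block_decay:
  fixes \<tau> \<kappa> :: real
  assumes \<tau>: "0 < \<tau>" "\<tau> < 1 / 2" and \<kappa>: "0 \<le> \<kappa>" "\<kappa> < 2 * sqrt (2 * \<tau>)"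
  obtains G where "G \<ge> 0"
    "\<And>n j. n \<ge> 2 \<Longrightarrow> (\<Sum>d\<in>divisor_block n j. 1 / real d)
        \<le> G * (ln (real n))\<^sup>2 * exp (- \<kappa> * sqrt (real j * ln (real j)))"
proof -
  have "\<forall>\<^sub>F j :: nat in sequentially. real j \<ge> 16" by real_asymp
  moreover have "\<forall>\<^sub>F j :: nat in sequentially. 4 * (real j powr \<tau> * (8 * ln (real j) + 7))
      \<le> (2 * sqrt (2 * \<tau>) - \<kappa>) * sqrt (real j * ln (real j))"
    using \<tau> \<kappa> by (intro rankin_error_eventually) auto
  ultimately have "\<forall>\<^sub>F j :: nat in sequentially. real j \<ge> 16 \<and> 4 * (real j powr \<tau> * (8 * ln (real j) + 7))
      \<le> (2 * sqrt (2 * \<tau>) - \<kappa>) * sqrt (real j * ln (real j))"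
    by (rule eventually_conj)
  then obtain J where J: "\<And>j. j \<ge> J \<Longrightarrow> real j \<ge> 16 \<and> 4 * (real j powr \<tau> * (8 * ln (real j) + 7))
      \<le> (2 * sqrt (2 * \<tau>) - \<kappa>) * sqrt (real j * ln (real j))"
    unfolding eventually_sequentially by blast
  \<comment> \<open>Here \<open>12 = 3 * 4\<close>, because \<open>4 * (ln n)^2 >= 1\<close> for
    \<open>n >= 2\<close>; the exponential compensates the decay factor for \<open>j < J\<close>,
    where \<open>S <= J\<close>.\<close>
  define G where "G = max 3 (12 * exp (\<kappa> * real J))"
  show ?thesis
  proof (rule that[of G])
    fix n j :: nat assume n: "n \<ge> 2"
    then have n1: "n \<ge> 1" by simp
    define S where "S = sqrt (real j * ln (real j))"
    show "(\<Sum>d\<in>divisor_block n j. 1 / real d) \<le> G * (ln (real n))\<^sup>2 * exp (- \<kappa> * sqrt (real j * ln (real j)))"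
    proof (cases "j < J")
      case True
      have "S \<le> real J" using sqrt_mult_ln_le[of j] True by (simp add: S_def)
      then have 1: "1 \<le> exp (\<kappa> * real J) * exp (- \<kappa> * S)"
        using \<kappa> by (simp add: exp_add[symmetric] mult_left_mono)
      have "1 / 2 \<le> ln (2::real)" using ln2_ge_two_thirds by simp
      also have "\<dots> \<le> ln (real n)" using n by simp
      finally have "(1 / 2)\<^sup>2 \<le> (ln (real n))\<^sup>2" by (intro power_mono) auto
      then have 2: "1 \<le> 4 * (ln (real n))\<^sup>2" by (simp add: power2_eq_square)
      have "3 * (1 * 1) \<le> 3 * ((exp (\<kappa> * real J) * exp (- \<kappa> * S)) * (4 * (ln (real n))\<^sup>2))"
        using 1 2 by (intro mult_left_mono mult_mono) auto
      also have "\<dots> = (12 * exp (\<kappa> * real J)) * ((ln (real n))\<^sup>2 * exp (- \<kappa> * S))" by simp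
      also have "\<dots> \<le> G * ((ln (real n))\<^sup>2 * exp (- \<kappa> * S))"
        by (intro mult_right_mono) (auto simp: G_def)
      finally show ?thesis
        using sum_divisor_block_le_3[OF n1, of j] by (simp add: S_def mult.assoc)
    next
      case False
      show ?thesis
      proof (cases "real j \<le> ln (real n)")
        case True
        have "(\<Sum>d\<in>divisor_block n j. 1 / real d) \<le> 3 * (ln (real n))\<^sup>2 * exp (- \<kappa> * S)"
          unfolding S_def using J[of j] False \<tau> \<kappa> n True by (intro divisor_block_large) auto
        also have "\<dots> \<le> G * (ln (real n))\<^sup>2 * exp (- \<kappa> * S)"
          by (intro mult_right_mono) (auto simp: G_def)
        finally show ?thesis by (simp add: S_def)
      next
        case gt: False
        have "divisor_block n j = {}"
        proof (rule ccontr)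
          assume "divisor_block n j \<noteq> {}"
          then obtain d where "d \<in> divisor_block n j" by blast
          then have d: "d dvd n" "exp (real j) \<le> real d" using divisor_blockD n1 by blast+
          then have "exp (real j) \<le> real n" using n by (meson dvd_imp_le less_le_trans of_nat_le_iff order_trans pos2)
          then show False using gt n by (simp add: ln_ge_iff)
        qed
        then show ?thesis by (simp add: G_def)
      qed
    qed
  qed (simp add: G_def)
qed

section \<open>The weight and the weighted sum over divisors\<close>

definition weight :: "real \<Rightarrow> nat \<Rightarrow> real" where
  "weight c n = real n * exp (- c * sqrt (ln (real n) * loglog (real n)))"

lemma weight_pos: "n \<ge> 1 \<Longrightarrow> weight c n > 0"
  by (simp add: weight_def)

text \<open>The cut-off \<open>exp (exp 1)\<close> is exactly where \<open>ln (ln x) = 1\<close>.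
  The maximum makes monotonicity of \<open>loglog\<close> on \<open>x > 1\<close> available.\<close>

lemma loglog_eq_max:
  assumes "x > 1"
  shows "loglog x = max 1 (ln (ln x))"
proof (cases "x > exp (exp 1)")
  case True
  then have "ln (exp (exp 1)) < ln x" using assms by (subst ln_less_cancel_iff) auto
  then have "exp 1 < ln x" by simp
  then have "ln (exp 1) < ln (ln x)" using assms by (subst ln_less_cancel_iff) auto
  then have "1 < ln (ln x)" by simp
  then show ?thesis using True by (simp add: loglog_def)
next
  case False
  then have "ln x \<le> exp 1" using assms by (metis exp_gt_zero less_trans ln_le_cancel_iff ln_exp not_less zero_less_one)
  then have "ln (ln x) \<le> 1" using assms by (metis exp_gt_zero ln_gt_zero ln_le_cancel_iff ln_exp)
  then show ?thesis using False by (simp add: loglog_def)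
qed

lemma loglog_nonneg: "loglog x \<ge> 0"
proof (cases "x > exp (exp 1)")
  case True
  moreover have "(1 :: real) < exp (exp 1)" by simp
  ultimately have "x > 1" by (rule less_trans[rotated])
  then show ?thesis using loglog_eq_max[of x] by simp
qed (simp add: loglog_def)

text \<open>Group the divisors by the integer part \<open>j\<close> of \<open>ln d\<close>. The
  block decay with some \<open>\<kappa> > c\<close> beats the growth of the inverse weight, leaving
  a series in \<open>j\<close> that converges independently of \<open>n\<close>.\<close>

lemma sum_divisors_weight:
  assumes c: "0 \<le> c" "c < 2"
  obtains C where "C > 0"
    "\<And>n. n \<ge> 2 \<Longrightarrow> (\<Sum>d | d dvd n \<and> d \<ge> 2. (ln (real d))\<^sup>2 / weight c d) \<le> C * (ln (real n))\<^sup>2"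
proof -
  \<comment> \<open>\<open>\<kappa>\<close> is the midpoint of \<open>c\<close> and 2, and
    \<open>\<tau>\<close> is chosen such that \<open>2 * sqrt (2 * \<tau>)\<close> is the midpoint
    of \<open>\<kappa>\<close> and 2.\<close>
  define \<kappa> where "\<kappa> = (c + 2) / 2"
  define \<tau> where "\<tau> = ((\<kappa> + 2) / 2)\<^sup>2 / 8"
  have \<kappa>: "0 \<le> \<kappa>" "c < \<kappa>" "\<kappa> < 2" using c by (auto simp: \<kappa>_def)
  have "((\<kappa> + 2) / 2)\<^sup>2 < 2\<^sup>2" using \<kappa> by (intro power_strict_mono) auto
  then have \<tau>: "0 < \<tau>" "\<tau> < 1 / 2" using \<kappa> by (auto simp: \<tau>_def)
  have "2 * sqrt (2 * \<tau>) = sqrt (((\<kappa> + 2) / 2)\<^sup>2)"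
    by (simp add: \<tau>_def real_sqrt_divide real_sqrt_mult power_divide)
  also have "\<dots> = (\<kappa> + 2) / 2" using \<kappa> by (subst real_sqrt_abs) simp
  finally have "\<kappa> < 2 * sqrt (2 * \<tau>)" using \<kappa> by simp
  then obtain G where G: "G \<ge> 0" "\<And>n j. n \<ge> 2 \<Longrightarrow> (\<Sum>d\<in>divisor_block n j. 1 / real d)
        \<le> G * (ln (real n))\<^sup>2 * exp (- \<kappa> * sqrt (real j * ln (real j)))"
    using divisor_block_decay[OF \<tau> \<kappa>(1)] by blast
  \<comment> \<open>Since \<open>ln d < j + 1\<close> on block \<open>j\<close>, \<open>A j\<close>
    dominates \<open>(ln d)^2 * d / weight c d\<close> there.\<close>
  define A where "A j = (real j + 1)\<^sup>2 * exp (c * sqrt ((real j + 1) * max 1 (ln (real j + 1))))" for j :: nat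
  define D where "D j = A j * exp (- \<kappa> * sqrt (real j * ln (real j)))" for j :: nat
  have A0: "A j \<ge> 0" for j by (simp add: A_def)
  have D: "summable D"
  proof (rule summable_comparison_test_bigo)
    show "summable (\<lambda>n. norm (1 / real n ^ 2))"
      using inverse_power_summable[of 2, where ?'a = real] by (simp add: inverse_eq_divide)
    define E where "E = (\<lambda>j :: nat. (real j + 1)\<^sup>2 * exp (- (\<kappa> - c) * sqrt (real j * ln (real j))))"
    have "\<forall>\<^sub>F j :: nat in sequentially. 1 \<le> ln (real j + 1)" by real_asymp
    \<comment> \<open>Replacing \<open>j + 1\<close> by \<open>j\<close> under the root costs at
      most 1, hence only the factor \<open>exp c\<close> below.\<close>
    moreover have "\<forall>\<^sub>F j :: nat in sequentially.
        sqrt ((real j + 1) * ln (real j + 1)) \<le> sqrt (real j * ln (real j)) + 1" by real_asymp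
    ultimately have "\<forall>\<^sub>F j in sequentially. norm (D j) \<le> exp c * norm (E j)"
    proof eventually_elim
      case (elim j)
      have "c * sqrt ((real j + 1) * ln (real j + 1)) \<le> c * (sqrt (real j * ln (real j)) + 1)"
        using elim(2) c by (intro mult_left_mono) auto
      then have "exp (c * sqrt ((real j + 1) * ln (real j + 1)) - \<kappa> * sqrt (real j * ln (real j)))
          \<le> exp (c - (\<kappa> - c) * sqrt (real j * ln (real j)))" by (simp add: algebra_simps)
      then have "(real j + 1)\<^sup>2 * exp (c * sqrt ((real j + 1) * ln (real j + 1)) - \<kappa> * sqrt (real j * ln (real j)))
          \<le> (real j + 1)\<^sup>2 * exp (c - (\<kappa> - c) * sqrt (real j * ln (real j)))" by (intro mult_left_mono) auto
      moreover have "max 1 (ln (real j + 1)) = ln (real j + 1)" using elim(1) by simp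
      ultimately show ?case
        by (simp add: D_def A_def E_def abs_mult exp_diff exp_minus divide_inverse minus_mult_left[symmetric]
            del: minus_mult_left minus_diff_eq)
    qed
    then have "D \<in> O(E)" by (rule bigoI)
    moreover have "E \<in> O(\<lambda>n. 1 / real n ^ 2)"
    proof -
      define \<delta> where "\<delta> = \<kappa> - c"
      have "\<delta> > 0" using \<kappa> by (simp add: \<delta>_def)
      then show ?thesis unfolding E_def \<delta>_def[symmetric] by real_asymp
    qed
    ultimately show "D \<in> O(\<lambda>n. 1 / real n ^ 2)" by (rule landau_o.big_trans)
  qed
  have D0: "D j \<ge> 0" for j using A0 by (simp add: D_def)
  show ?thesis
  proof (rule that[of "G * suminf D + 1"])
    have "0 \<le> suminf D" using D D0 by (rule suminf_nonneg)
    then show "0 < G * suminf D + 1" using G(1) by (intro add_nonneg_pos mult_nonneg_nonneg) auto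
    fix n :: nat assume n: "n \<ge> 2"
    let ?X = "{d. d dvd n \<and> d \<ge> 2}"
    define J where "J d = nat \<lfloor>ln (real d)\<rfloor>" for d :: nat
    have fin: "finite ?X" using n by (intro finite_subset[of ?X "{d. d dvd n}"]) auto
    have term_le: "(ln (real d))\<^sup>2 / weight c d \<le> A (J d) * (1 / real d)" if d: "d \<in> ?X" for d
    proof -
      have d2: "real d \<ge> 2" using d by simp
      then have l0: "ln (real d) > 0" by simp
      have l: "ln (real d) \<le> real (J d) + 1" using l0 unfolding J_def by linarith
      have "ln (ln (real d)) \<le> ln (real (J d) + 1)" using l l0 by (subst ln_le_cancel_iff) auto
      then have "max 1 (ln (ln (real d))) \<le> max 1 (ln (real (J d) + 1))"
        by (rule max.mono[OF order_refl])
      then have "loglog (real d) \<le> max 1 (ln (real (J d) + 1))"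
        using loglog_eq_max[of "real d"] d2 by simp
      then have "sqrt (ln (real d) * loglog (real d)) \<le> sqrt ((real (J d) + 1) * max 1 (ln (real (J d) + 1)))"
        using l l0 by (intro real_sqrt_le_mono mult_mono) (auto simp: loglog_nonneg)
      then have "exp (c * sqrt (ln (real d) * loglog (real d))) \<le> exp (c * sqrt ((real (J d) + 1) * max 1 (ln (real (J d) + 1))))"
        using c by (simp add: mult_left_mono)
      moreover have "(ln (real d))\<^sup>2 \<le> (real (J d) + 1)\<^sup>2" using l l0 by (intro power_mono) auto
      ultimately have "(ln (real d))\<^sup>2 * exp (c * sqrt (ln (real d) * loglog (real d))) \<le> A (J d)"
        unfolding A_def by (intro mult_mono) auto
      then have "(ln (real d))\<^sup>2 * exp (c * sqrt (ln (real d) * loglog (real d))) * (1 / real d) \<le> A (J d) * (1 / real d)"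
        by (intro mult_right_mono) auto
      then show ?thesis by (simp add: weight_def exp_minus divide_inverse mult_ac)
    qed
    have "(\<Sum>d\<in>?X. (ln (real d))\<^sup>2 / weight c d) \<le> (\<Sum>d\<in>?X. A (J d) * (1 / real d))"
      using term_le by (intro sum_mono) auto
    also have "\<dots> = (\<Sum>j\<in>J ` ?X. \<Sum>d\<in>{d\<in>?X. J d = j}. A (J d) * (1 / real d))"
      using fin by (intro sum.group[symmetric]) auto
    also have "\<dots> \<le> (\<Sum>j\<in>J ` ?X. G * (ln (real n))\<^sup>2 * D j)"
    proof (intro sum_mono)
      fix j
      have "(\<Sum>d\<in>{d\<in>?X. J d = j}. 1 / real d) \<le> (\<Sum>d\<in>divisor_block n j. 1 / real d)"
        using n by (intro sum_mono2 finite_divisor_block) (auto simp: divisor_block_def J_def)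
      also have "\<dots> \<le> G * (ln (real n))\<^sup>2 * exp (- \<kappa> * sqrt (real j * ln (real j)))"
        using n by (rule G(2))
      finally have "A j * (\<Sum>d\<in>{d\<in>?X. J d = j}. 1 / real d)
          \<le> A j * (G * (ln (real n))\<^sup>2 * exp (- \<kappa> * sqrt (real j * ln (real j))))"
        using A0 by (rule mult_left_mono)
      also have "\<dots> = G * (ln (real n))\<^sup>2 * D j" by (simp add: D_def)
      finally show "(\<Sum>d\<in>{d\<in>?X. J d = j}. A (J d) * (1 / real d)) \<le> G * (ln (real n))\<^sup>2 * D j"
        by (simp add: sum_distrib_left)
    qed
    also have "\<dots> = (G * (ln (real n))\<^sup>2) * sum D (J ` ?X)" by (simp add: sum_distrib_left)
    also have "\<dots> \<le> (G * (ln (real n))\<^sup>2) * suminf D"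
      using G(1) D D0 fin by (intro mult_left_mono sum_le_suminf) auto
    also have "\<dots> \<le> (G * suminf D + 1) * (ln (real n))\<^sup>2" by (simp add: algebra_simps)
    finally show "(\<Sum>d\<in>?X. (ln (real d))\<^sup>2 / weight c d) \<le> (G * suminf D + 1) * (ln (real n))\<^sup>2" .
  qed
qed

subsection \<open>The upper bound\<close>

lemma weighted_norm_eq:
  "weighted_norm c b = ennreal_sqrt (\<Sum>n. ennreal ((cmod (b (n + 2)))\<^sup>2 * weight c (n + 2)))"
  by (simp add: weighted_norm_def weight_def Let_def)

lemma ennreal_sqrt_mono:
  assumes "x \<le> y"
  shows "ennreal_sqrt x \<le> ennreal_sqrt y"
proof (cases "y = \<infinity>")
  case False
  then have "x \<noteq> \<infinity>" "y < \<infinity>" using assms by (auto simp: top_unique less_top)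
  with False show ?thesis
    using enn2real_mono[OF assms] by (simp add: ennreal_sqrt_def ennreal_leI)
qed (simp add: ennreal_sqrt_def)

lemma nonneg_sums_imp_has_sum_Suc:
  fixes u :: "nat \<Rightarrow> real"
  assumes "\<And>n. u n \<ge> 0" "(\<lambda>n. u (Suc n)) sums S"
  shows "(\<lambda>n. norm (u n)) summable_on {1..}" and "(u has_sum S) {1..}"
proof -
  have "summable (\<lambda>n. norm (u (Suc n)))" using assms by (simp add: sums_summable)
  from norm_summable_sums_imp_has_sum_Suc[OF this assms(2)]
  show "(\<lambda>n. norm (u n)) summable_on {1..}" and "(u has_sum S) {1..}" .
qed

text \<open>Cauchy--Schwarz with \<open>sqrt (weight c d)\<close> distributed between the two
  factors. The bound is kept as a Dirichlet convolution, so that summation over \<open>n\<close>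
  factorises; \<open>d = 1\<close> drops out because \<open>ln 1 = 0\<close>.\<close>

lemma volterra_coeff_le:
  assumes C: "\<And>n. n \<ge> 2 \<Longrightarrow> (\<Sum>d | d dvd n \<and> d \<ge> 2. (ln (real d))\<^sup>2 / weight c d) \<le> C * (ln (real n))\<^sup>2"
    and "n \<ge> 1" "C \<ge> 0"
  shows "(cmod (volterra_coeff b a n))\<^sup>2 \<le>
    C * (\<Sum>d | d dvd n. (cmod (a (n div d)))\<^sup>2 * (if d \<ge> 2 then (cmod (b d))\<^sup>2 * weight c d else 0))"
proof (cases "n = 1")
  case True
  then show ?thesis using assms by (simp add: volterra_coeff_def)
next
  case False
  then have n: "n \<ge> 2" using assms by simp
  then have lnn: "ln (real n) > 0" by simp
  let ?X = "{d. d dvd n \<and> d \<ge> 2}"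
  define u where "u d = cmod (a (n div d)) * cmod (b d) * sqrt (weight c d)" for d
  define v where "v d = ln (real d) / sqrt (weight c d)" for d
  have fin: "finite {d. d dvd n}" using n by simp
  have "(\<Sum>d | d dvd n. a (n div d) * (b d * of_real (ln (real d)))) =
      (\<Sum>d\<in>?X. a (n div d) * (b d * of_real (ln (real d))))"
  proof (intro sum.mono_neutral_right fin ballI)
    fix d assume "d \<in> {d. d dvd n} - ?X"
    then have "d = 0 \<or> d = 1" by auto
    then show "a (n div d) * (b d * of_real (ln (real d))) = 0" by auto
  qed auto
  also have "cmod \<dots> \<le> (\<Sum>d\<in>?X. u d * v d)"
  proof (intro sum_norm_le)
    fix d assume d: "d \<in> ?X"
    then have "weight c d > 0" by (intro weight_pos) simp
    then show "cmod (a (n div d) * (b d * of_real (ln (real d)))) \<le> u d * v d"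
      using d by (simp add: u_def v_def norm_mult)
  qed
  finally have "(cmod (\<Sum>d | d dvd n. a (n div d) * (b d * of_real (ln (real d)))))\<^sup>2 \<le> (\<Sum>d\<in>?X. u d * v d)\<^sup>2"
    by (intro power_mono) auto
  also have "\<dots> \<le> (\<Sum>d\<in>?X. (u d)\<^sup>2) * (\<Sum>d\<in>?X. (v d)\<^sup>2)" by (rule Cauchy_Schwarz_ineq_sum)
  also have "(\<Sum>d\<in>?X. (v d)\<^sup>2) = (\<Sum>d\<in>?X. (ln (real d))\<^sup>2 / weight c d)"
    by (intro sum.cong refl) (simp add: v_def power_divide less_imp_le[OF weight_pos])
  also have "(\<Sum>d\<in>?X. (u d)\<^sup>2) * \<dots> \<le> (\<Sum>d\<in>?X. (u d)\<^sup>2) * (C * (ln (real n))\<^sup>2)"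
    using C n by (intro mult_left_mono sum_nonneg) auto
  also have "(\<Sum>d\<in>?X. (u d)\<^sup>2) =
      (\<Sum>d\<in>?X. (cmod (a (n div d)))\<^sup>2 * (if d \<ge> 2 then (cmod (b d))\<^sup>2 * weight c d else 0))"
    by (intro sum.cong refl) (simp add: u_def power_mult_distrib less_imp_le[OF weight_pos])
  also have "\<dots> = (\<Sum>d | d dvd n. (cmod (a (n div d)))\<^sup>2 * (if d \<ge> 2 then (cmod (b d))\<^sup>2 * weight c d else 0))"
    by (intro sum.mono_neutral_left fin) auto
  finally show ?thesis
    using lnn by (simp add: volterra_coeff_def norm_divide power_divide field_simps)
qed

text \<open>Summing the coefficient bounds over \<open>n\<close> gives \<open>C * (A * B)\<close>,
  where \<open>A <= 1\<close> is the squared norm of \<open>f\<close> and \<open>B\<close> is the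
  squared weighted norm of \<open>b\<close>.\<close>

lemma volterra_norm_le:
  assumes C: "\<And>n. n \<ge> 2 \<Longrightarrow> (\<Sum>d | d dvd n \<and> d \<ge> 2. (ln (real d))\<^sup>2 / weight c d) \<le> C * (ln (real n))\<^sup>2"
    and "C > 0" and g: "dirichlet_expansion b g"
  shows "volterra_norm g \<le> ennreal (sqrt C) * weighted_norm c b"
  unfolding volterra_norm_def
proof (rule SUP_least)
  fix f assume "f \<in> {f \<in> H2. H2_norm f \<le> 1}"
  then have "f \<in> dirichlet_class" and f1: "H2_norm f \<le> 1" by (auto simp: H2_def)
  then obtain a where f: "dirichlet_expansion a f" by (auto simp: dirichlet_class_def)
  let ?W = "\<Sum>n. ennreal ((cmod (b (n + 2)))\<^sup>2 * weight c (n + 2))"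
  show "H2_norm (volterra g f) \<le> ennreal (sqrt C) * weighted_norm c b"
  proof (cases "?W = \<infinity>")
    case True
    then have "weighted_norm c b = \<infinity>" by (simp add: weighted_norm_eq ennreal_sqrt_def)
    \<comment> \<open>Positivity of \<open>C\<close> matters here: in \<open>ennreal\<close> the
      product of 0 and infinity is 0.\<close>
    then show ?thesis using \<open>C > 0\<close> by (simp add: ennreal_mult_top)
  next
    case False
    define \<alpha> where "\<alpha> n = (cmod (a n))\<^sup>2" for n
    define \<beta> where "\<beta> n = (if n \<ge> 2 then (cmod (b n))\<^sup>2 * weight c n else 0)" for n
    have \<beta>0: "\<beta> n \<ge> 0" for n by (simp add: \<beta>_def less_imp_le[OF weight_pos])
    have \<alpha>0: "\<alpha> n \<ge> 0" for n by (simp add: \<alpha>_def)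
    have \<beta>_eq: "(cmod (b (n + 2)))\<^sup>2 * weight c (n + 2) = \<beta> (n + 2)" for n by (simp add: \<beta>_def)
    have "summable (\<lambda>n. \<beta> (n + 2))"
      using False \<beta>0 unfolding \<beta>_eq infinity_ennreal_def by (intro summable_suminf_not_top)
    then have \<beta>2: "(\<lambda>n. \<beta> (n + 2)) sums (\<Sum>n. \<beta> (n + 2))" by (rule summable_sums)
    define B where "B = (\<Sum>n. \<beta> (n + 2))"
    have W: "weighted_norm c b = ennreal (sqrt B)"
    proof -
      have "?W = ennreal B"
        unfolding \<beta>_eq B_def using \<beta>0 \<beta>2 by (intro suminf_ennreal_eq)
      moreover have "B \<ge> 0" unfolding B_def using \<beta>2 \<beta>0 by (intro suminf_nonneg) (auto simp: sums_iff)
      ultimately show ?thesis by (simp add: weighted_norm_eq ennreal_sqrt_ennreal)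
    qed
    have "(\<lambda>n. \<beta> (Suc n)) sums (B + \<beta> (Suc 0))"
      using sums_Suc[of "\<lambda>n. \<beta> (Suc n)" B] \<beta>2 by (simp add: B_def)
    then have \<beta>_sums: "(\<lambda>n. \<beta> (Suc n)) sums B" by (simp add: \<beta>_def)
    have \<alpha>1: "(\<Sum>n. ennreal (\<alpha> (Suc n))) \<le> 1"
    proof -
      let ?A = "\<Sum>n. ennreal (\<alpha> (Suc n))"
      have "ennreal_sqrt ?A \<le> 1" using f1 H2_norm_eq[OF f] by (simp add: \<alpha>_def)
      moreover from this have "?A \<noteq> \<infinity>" by (auto simp: ennreal_sqrt_def top_unique split: if_splits)
      ultimately have "sqrt (enn2real ?A) \<le> 1" by (simp add: ennreal_sqrt_def)
      then have "enn2real ?A \<le> 1" by simp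
      then show ?thesis using \<open>?A \<noteq> \<infinity>\<close>
        by (metis ennreal_1 ennreal_enn2real_if ennreal_leI infinity_ennreal_def)
    qed
    then have "(\<Sum>n. ennreal (\<alpha> (Suc n))) \<noteq> \<infinity>" by (auto simp: top_unique)
    then have "summable (\<lambda>n. \<alpha> (Suc n))" using \<alpha>0 by (intro summable_suminf_not_top) auto
    then have \<alpha>_sums: "(\<lambda>n. \<alpha> (Suc n)) sums (\<Sum>n. \<alpha> (Suc n))" by (rule summable_sums)
    define A where "A = (\<Sum>n. \<alpha> (Suc n))"
    have "(\<Sum>n. ennreal (\<alpha> (Suc n))) = ennreal A"
      unfolding A_def using \<alpha>0 \<alpha>_sums by (intro suminf_ennreal_eq)
    then have A1: "A \<le> 1" using \<alpha>1 by (simp only: ennreal_le_1)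
    have B0: "B \<ge> 0" unfolding B_def using \<beta>2 \<beta>0 by (intro suminf_nonneg) (auto simp: sums_iff)
    have \<alpha>h: "(\<lambda>n. norm (\<alpha> n)) summable_on {1..}" "(\<alpha> has_sum A) {1..}"
      unfolding A_def using \<alpha>0 \<alpha>_sums by (rule nonneg_sums_imp_has_sum_Suc)+
    have \<beta>h: "(\<lambda>n. norm (\<beta> n)) summable_on {1..}" "(\<beta> has_sum B) {1..}"
      using \<beta>0 \<beta>_sums by (rule nonneg_sums_imp_has_sum_Suc)+
    define \<gamma> where "\<gamma> n = (\<Sum>d | d dvd n. \<alpha> (n div d) * \<beta> d)" for n
    have "(\<gamma> has_sum A * B) {1..}"
      unfolding \<gamma>_def using dirichlet_convolution_has_sum[OF \<alpha>h(1) \<beta>h(1)] \<alpha>h(2) \<beta>h(2)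
      by (simp add: infsumI)
    then have "(\<lambda>n. \<gamma> (Suc n)) sums (A * B)"
      unfolding has_sum_Suc_iff[of \<gamma>, symmetric] by (rule has_sum_imp_sums)
    then have \<gamma>_sums: "(\<lambda>n. C * \<gamma> (Suc n)) sums (C * (A * B))" by (rule sums_mult)
    have \<gamma>0: "\<gamma> n \<ge> 0" for n unfolding \<gamma>_def by (intro sum_nonneg mult_nonneg_nonneg \<alpha>0 \<beta>0)
    have "H2_norm (volterra g f) = ennreal_sqrt (\<Sum>n. ennreal ((cmod (volterra_coeff b a (Suc n)))\<^sup>2))"
      using dirichlet_expansion_volterra[OF f g] by (rule H2_norm_eq)
    also have "\<dots> \<le> ennreal_sqrt (\<Sum>n. ennreal (C * \<gamma> (Suc n)))"
    proof (intro ennreal_sqrt_mono suminf_le ennreal_leI summableI)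
      fix n
      show "(cmod (volterra_coeff b a (Suc n)))\<^sup>2 \<le> C * \<gamma> (Suc n)"
        unfolding \<gamma>_def \<alpha>_def \<beta>_def using C \<open>C > 0\<close> by (intro volterra_coeff_le) auto
    qed
    also have "(\<Sum>n. ennreal (C * \<gamma> (Suc n))) = ennreal (C * (A * B))"
      using \<gamma>_sums \<gamma>0 \<open>C > 0\<close> by (intro suminf_ennreal_eq) auto
    also have "ennreal_sqrt \<dots> \<le> ennreal_sqrt (ennreal (C * B))"
      using A1 B0 \<open>C > 0\<close> mult_right_mono[of A 1 B]
      by (intro ennreal_sqrt_mono ennreal_leI mult_left_mono) auto
    also have "\<dots> = ennreal (sqrt C * sqrt B)"
      using B0 \<open>C > 0\<close> by (simp add: ennreal_sqrt_ennreal real_sqrt_mult)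
    also have "\<dots> = ennreal (sqrt C) * weighted_norm c b"
      using B0 \<open>C > 0\<close> by (simp add: W ennreal_mult)
    finally show ?thesis .
  qed
qed

text \<open>This reduces the upper bound to exponents \<open>c >= 0\<close>: a negative
  \<open>c\<close> is replaced by 0, which only shrinks the weighted norm.\<close>

lemma weighted_norm_antimono:
  assumes "c \<le> c'"
  shows "weighted_norm c' b \<le> weighted_norm c b"
  unfolding weighted_norm_eq
proof (intro ennreal_sqrt_mono suminf_le ennreal_leI mult_left_mono summableI)
  fix n
  have "sqrt (ln (real (n + 2)) * loglog (real (n + 2))) \<ge> 0" using loglog_nonneg by simp
  then show "weight c' (n + 2) \<le> weight c (n + 2)"
    unfolding weight_def using assms by (intro mult_left_mono) (auto intro!: mult_right_mono)
qed auto

lemma volterra_norm_upper: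
  assumes "c < 2"
  shows "\<exists>C::real. C > 0 \<and> (\<forall>b g. dirichlet_expansion b g \<longrightarrow>
           volterra_norm g \<le> ennreal C * weighted_norm c b)"
proof -
  have "0 \<le> max c 0" "max c 0 < 2" using assms by auto
  then obtain C where C: "C > 0" "\<And>n. n \<ge> 2 \<Longrightarrow>
      (\<Sum>d | d dvd n \<and> d \<ge> 2. (ln (real d))\<^sup>2 / weight (max c 0) d) \<le> C * (ln (real n))\<^sup>2"
    using sum_divisors_weight by blast
  show ?thesis
  proof (intro exI[of _ "sqrt C"] conjI allI impI)
    show "sqrt C > 0" using C by simp
    fix b g assume g: "dirichlet_expansion b g"
    have "volterra_norm g \<le> ennreal (sqrt C) * weighted_norm (max c 0) b"
      using C g by (intro volterra_norm_le) auto
    also have "\<dots> \<le> ennreal (sqrt C) * weighted_norm c b"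
      by (intro mult_left_mono weighted_norm_antimono) auto
    finally show "volterra_norm g \<le> ennreal (sqrt C) * weighted_norm c b" .
  qed
qed

subsection \<open>The lower bound\<close>

text \<open>Induction on the degree. Removing fewer than \<open>k\<close> elements lowers the total
  by at most \<open>k * \<epsilon>\<close>, so at least \<open>\<eta>\<close> is left for one
  further factor, and every set of size \<open>j + 1\<close> is produced \<open>j + 1\<close>
  times.\<close>

lemma elementary_symmetric_lower_bound:
  fixes x :: "'a \<Rightarrow> real"
  assumes "finite P" and x: "\<And>p. p \<in> P \<Longrightarrow> 0 \<le> x p \<and> x p \<le> \<epsilon>" and "\<eta> \<ge> 0" "\<epsilon> \<ge> 0"
    and \<eta>: "\<eta> + real k * \<epsilon> \<le> sum x P"
  shows "\<eta> ^ k \<le> fact k * (\<Sum>A | A \<subseteq> P \<and> card A = k. prod x A)"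
proof -
  define e where "e j = (\<Sum>A | A \<subseteq> P \<and> card A = j. prod x A)" for j
  have fin: "finite {A. A \<subseteq> P \<and> Q A}" for Q
    using assms(1) by (intro finite_subset[of "{A. A \<subseteq> P \<and> Q A}" "Pow P"]) auto
  have prod0: "prod x A \<ge> 0" if "A \<subseteq> P" for A
    using that x by (intro prod_nonneg) auto
  have step: "e j * \<eta> \<le> real (Suc j) * e (Suc j)" if j: "j < k" for j
  proof -
    have "e j * \<eta> = (\<Sum>B | B \<subseteq> P \<and> card B = j. prod x B * \<eta>)"
      by (simp add: e_def sum_distrib_right)
    also have "\<dots> \<le> (\<Sum>B | B \<subseteq> P \<and> card B = j. prod x B * (\<Sum>p\<in>P - B. x p))"
    proof (intro sum_mono mult_left_mono)
      fix B assume B: "B \<in> {B. B \<subseteq> P \<and> card B = j}"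
      then have "sum x B \<le> real (card B) * \<epsilon>" using x by (intro sum_bounded_above) auto
      also have "\<dots> \<le> real k * \<epsilon>" using B j assms(4) by (intro mult_right_mono) auto
      finally have "\<eta> \<le> sum x P - sum x B" using \<eta> by linarith
      also have "\<dots> = (\<Sum>p\<in>P - B. x p)" using B assms(1) by (intro sum_diff[symmetric]) auto
      finally show "\<eta> \<le> (\<Sum>p\<in>P - B. x p)" .
    qed (use prod0 in auto)
    also have "\<dots> = (\<Sum>(B, p)\<in>(SIGMA B:{B. B \<subseteq> P \<and> card B = j}. P - B). prod x B * x p)"
      using fin assms(1) by (simp add: sum_distrib_left sum.Sigma)
    \<comment> \<open>A set \<open>B\<close> with a new element \<open>p\<close> corresponds to
      \<open>insert p B\<close> with the marked element \<open>p\<close>.\<close>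
    also have "\<dots> = (\<Sum>(A, p)\<in>(SIGMA A:{A. A \<subseteq> P \<and> card A = Suc j}. A). prod x A)"
    proof (rule sum.reindex_bij_witness[where i = "\<lambda>(A, p). (A - {p}, p)" and j = "\<lambda>(B, p). (insert p B, p)"])
      fix a assume a: "a \<in> (SIGMA B:{B. B \<subseteq> P \<and> card B = j}. P - B)"
      then obtain B p where Bp: "a = (B, p)" "B \<subseteq> P" "card B = j" "p \<in> P" "p \<notin> B" by auto
      then have "finite B" using assms(1) finite_subset by blast
      with Bp show "(case (case a of (B, p) \<Rightarrow> (insert p B, p)) of (A, p) \<Rightarrow> (A - {p}, p)) = a"
        "(case a of (B, p) \<Rightarrow> (insert p B, p)) \<in> (SIGMA A:{A. A \<subseteq> P \<and> card A = Suc j}. A)"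
        "(case (case a of (B, p) \<Rightarrow> (insert p B, p)) of (A, p) \<Rightarrow> prod x A) = (case a of (B, p) \<Rightarrow> prod x B * x p)"
        by auto
    next
      fix b assume b: "b \<in> (SIGMA A:{A. A \<subseteq> P \<and> card A = Suc j}. A)"
      then obtain A p where Ap: "b = (A, p)" "A \<subseteq> P" "card A = Suc j" "p \<in> A" by auto
      then have "finite A" using assms(1) finite_subset by blast
      with Ap show "(case (case b of (A, p) \<Rightarrow> (A - {p}, p)) of (B, p) \<Rightarrow> (insert p B, p)) = b"
        "(case b of (A, p) \<Rightarrow> (A - {p}, p)) \<in> (SIGMA B:{B. B \<subseteq> P \<and> card B = j}. P - B)"
        by auto
    qed
    also have "\<dots> = (\<Sum>A | A \<subseteq> P \<and> card A = Suc j. \<Sum>p\<in>A. prod x A)"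
      using fin assms(1) by (subst sum.Sigma) (auto intro: finite_subset)
    also have "\<dots> = real (Suc j) * e (Suc j)"
      by (simp add: e_def sum_distrib_left)
    finally show ?thesis .
  qed
  have "j \<le> k \<Longrightarrow> \<eta> ^ j \<le> fact j * e j" for j
  proof (induction j)
    case 0
    have "{A. A \<subseteq> P \<and> card A = 0} = {{}}" using assms(1) finite_subset by (auto simp: card_eq_0_iff)
    then show ?case by (simp add: e_def)
  next
    case (Suc j)
    then have "\<eta> * \<eta> ^ j \<le> \<eta> * (fact j * e j)" using assms(3) by (intro mult_left_mono) auto
    then have "\<eta> ^ Suc j \<le> (fact j * e j) * \<eta>" by (simp add: mult.commute)
    also have "\<dots> = fact j * (e j * \<eta>)" by simp
    also have "\<dots> \<le> fact j * (real (Suc j) * e (Suc j))" using step[of j] Suc.prems by (intro mult_left_mono) auto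
    finally show ?case by (simp add: algebra_simps)
  qed
  then show ?thesis by (simp add: e_def)
qed

section \<open>Test functions on squarefree products of primes\<close>

lemma prod_primes_inj:
  assumes "finite P" "\<And>p :: nat. p \<in> P \<Longrightarrow> prime p"
  shows "inj_on \<Prod> (Pow P)"
proof (rule inj_onI)
  fix A B assume A: "A \<in> Pow P" and B: "B \<in> Pow P" and eq: "\<Prod>A = \<Prod>B"
  have "prime_factors (\<Prod>X) = X" if "X \<subseteq> P" for X
  proof -
    have fin: "finite X" using that assms(1) finite_subset by blast
    have "0 \<notin> X" using that assms(2) by force
    then have "prime_factors (\<Prod>X) = (\<Union>p\<in>X. prime_factors p)"
      using prime_factors_prod[of X "\<lambda>p. p"] fin by auto
    also have "\<dots> = (\<Union>p\<in>X. {p})"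
      using that assms(2) by (intro SUP_cong refl) (auto simp: prime_prime_factors)
    finally show ?thesis by simp
  qed
  with A B eq show "A = B" by (metis PowD)
qed

lemma dirichlet_expansion_finite:
  assumes "finite {n. a n \<noteq> 0}"
  shows "dirichlet_expansion a (\<lambda>s. \<Sum>n. a (Suc n) / of_nat (Suc n) powr s)"
proof -
  have "finite {n. a (Suc n) \<noteq> 0}"
    using finite_vimageI[OF assms, of Suc] by (simp add: vimage_def)
  then have "summable (\<lambda>n. a (Suc n) / of_nat (Suc n) powr s)" for s
    by (intro summable_finite[of "{n. a (Suc n) \<noteq> 0}"]) auto
  then show ?thesis unfolding dirichlet_expansion_def by (auto intro: summable_sums)
qed

text \<open>The shift \<open>m\<close> is 1 for \<open>H2_norm\<close> and 2 for
  \<open>weighted_norm\<close>.\<close>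

lemma suminf_ennreal_shift_finite:
  fixes u :: "nat \<Rightarrow> real"
  assumes "finite S" "\<And>n. u n \<ge> 0" "\<And>n. n \<notin> S \<Longrightarrow> u n = 0" "\<And>n. n \<in> S \<Longrightarrow> n \<ge> m"
  shows "(\<Sum>n. ennreal (u (n + m))) = ennreal (sum u S)"
proof -
  have bij: "(\<lambda>n. n + m) ` ((\<lambda>n. n - m) ` S) = S"
    using assms(4) by (force simp: image_image)
  have "(\<lambda>n. u (n + m)) sums (\<Sum>n\<in>(\<lambda>n. n - m) ` S. u (n + m))"
  proof (intro sums_finite)
    fix n assume "n \<notin> (\<lambda>n. n - m) ` S"
    then have "n + m \<notin> S" by force
    then show "u (n + m) = 0" by (rule assms(3))
  qed (use assms(1) in auto)
  also have "(\<Sum>n\<in>(\<lambda>n. n - m) ` S. u (n + m)) = sum u ((\<lambda>n. n + m) ` ((\<lambda>n. n - m) ` S))"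
    by (subst sum.reindex) (auto simp: inj_on_def)
  finally show ?thesis using assms(2) by (intro suminf_ennreal_eq) (auto simp: bij)
qed

lemma sum_le_suminf_ennreal_shift:
  fixes u :: "nat \<Rightarrow> real"
  assumes "finite S" "\<And>n. u n \<ge> 0" "\<And>n. n \<in> S \<Longrightarrow> n \<ge> m"
  shows "ennreal (sum u S) \<le> (\<Sum>n. ennreal (u (n + m)))"
proof -
  define v where "v n = (if n \<in> S then u n else 0)" for n
  have "sum u S = sum v S" by (simp add: v_def)
  also have "ennreal \<dots> = (\<Sum>n. ennreal (v (n + m)))"
    using assms by (intro suminf_ennreal_shift_finite[symmetric]) (auto simp: v_def)
  also have "\<dots> \<le> (\<Sum>n. ennreal (u (n + m)))"
    using assms(2) by (intro suminf_le summableI ennreal_leI) (auto simp: v_def)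
  finally show ?thesis .
qed

lemma card_supersets:
  assumes "finite P" "B \<subseteq> P"
  shows "card {A. B \<subseteq> A \<and> A \<subseteq> P} = 2 ^ (card P - card B)"
proof -
  have "bij_betw (\<lambda>A. A - B) {A. B \<subseteq> A \<and> A \<subseteq> P} (Pow (P - B))"
    by (rule bij_betw_byWitness[where f' = "\<lambda>A. A \<union> B"]) (use assms in auto)
  then have "card {A. B \<subseteq> A \<and> A \<subseteq> P} = card (Pow (P - B))" by (rule bij_betw_same_card)
  also have "\<dots> = 2 ^ (card P - card B)"
    using assms by (simp add: card_Pow card_Diff_subset finite_subset)
  finally show ?thesis .
qed

text \<open>Test the inequality on the normalised indicator of the divisors of
  \<open>\<Prod>P\<close> and on \<open>g\<close> with coefficients \<open>1 / d\<close> at the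
  products \<open>d\<close> of \<open>k\<close> elements. The squared weighted norm is at most
  \<open>E * exp (- c * S0)\<close>, while the squared norm of \<open>volterra g f\<close> is at
  least \<open>E^2 / (4 ^ k * L^2)\<close>; cancelling one \<open>E\<close> gives the claim.\<close>

lemma elementary_symmetric_bound_of_volterra_bound:
  fixes P :: "nat set"
  assumes P: "finite P" "\<And>p. p \<in> P \<Longrightarrow> prime p" "\<And>p. p \<in> P \<Longrightarrow> z \<le> real p"
    and z: "z \<ge> 3" and k: "k \<ge> 1" "real k * ln z \<ge> 1" and c: "c \<ge> 0" and C: "C \<ge> 0"
    and ineq: "\<And>b g. dirichlet_expansion b g \<Longrightarrow> volterra_norm g \<le> ennreal C * weighted_norm c b"
  shows "(\<Sum>A | A \<subseteq> P \<and> card A = k. \<Prod>p\<in>A. 1 / real p)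
    \<le> C\<^sup>2 * 4 ^ k * (ln (real (\<Prod>P)))\<^sup>2 * exp (- c * sqrt (real k * ln z * ln (real k * ln z)))"
proof -
  define K where "K = {A. A \<subseteq> P \<and> card A = k}"
  define D where "D = \<Prod> ` K"
  define N where "N = \<Prod> ` Pow P"
  define E where "E = (\<Sum>A\<in>K. 1 / real (\<Prod>A))"
  define m where "m = card P"
  define L where "L = ln (real (\<Prod>P))"
  define S0 where "S0 = sqrt (real k * ln z * ln (real k * ln z))"
  define a :: "nat \<Rightarrow> complex" where "a n = (if n \<in> N then of_real (1 / sqrt (2 ^ m)) else 0)" for n
  define b :: "nat \<Rightarrow> complex" where "b d = (if d \<in> D then of_real (1 / real d) else 0)" for d
  have inj: "inj_on \<Prod> (Pow P)" using prod_primes_inj P by blast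
  have KP: "K \<subseteq> Pow P" by (auto simp: K_def)
  then have finK: "finite K" using P(1) finite_subset by blast
  have finN: "finite N" and finD: "finite D" using P(1) finK by (auto simp: N_def D_def)
  have pos: "\<Prod>A \<ge> 1" if "A \<subseteq> P" for A
    using that P(2) by (intro prod_ge_1) (auto simp: prime_ge_1_nat Suc_le_eq prime_gt_0_nat)
  have large: "z ^ k \<le> real d" "real d \<ge> 3" if "d \<in> D" for d
  proof -
    obtain A where A: "A \<subseteq> P" "card A = k" "d = \<Prod>A" using \<open>d \<in> D\<close> by (auto simp: D_def K_def)
    have "z ^ k = (\<Prod>p\<in>A. z)" using A by simp
    also have "\<dots> \<le> (\<Prod>p\<in>A. real p)" using A P z by (intro prod_mono) auto
    finally show 1: "z ^ k \<le> real d" using A by simp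
    have "z ^ 1 \<le> z ^ k" using z k by (intro power_increasing) auto
    with 1 z show "real d \<ge> 3" by simp
  qed
  define f where "f = (\<lambda>s. \<Sum>n. a (Suc n) / of_nat (Suc n) powr s)"
  define g where "g = (\<lambda>s. \<Sum>n. b (Suc n) / of_nat (Suc n) powr s)"
  have f: "dirichlet_expansion a f"
    unfolding f_def using finN by (intro dirichlet_expansion_finite) (auto simp: a_def)
  have g: "dirichlet_expansion b g"
    unfolding g_def using finD by (intro dirichlet_expansion_finite) (auto simp: b_def)
  have cardN: "card N = 2 ^ m" unfolding N_def m_def using inj P(1) by (simp add: card_image card_Pow)
  have "H2_norm f = 1"
  proof -
    have "(\<Sum>n. ennreal ((cmod (a (n + 1)))\<^sup>2)) = ennreal (\<Sum>n\<in>N. (cmod (a n))\<^sup>2)"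
      using finN pos by (intro suminf_ennreal_shift_finite) (auto simp: a_def N_def)
    also have "(\<Sum>n\<in>N. (cmod (a n))\<^sup>2) = 1"
      by (simp add: a_def cardN power_divide norm_divide)
    finally show ?thesis using H2_norm_eq[OF f] ennreal_sqrt_ennreal[of 1] by simp
  qed
  moreover have "f \<in> dirichlet_class" using f by (auto simp: dirichlet_class_def)
  ultimately have "f \<in> {f \<in> H2. H2_norm f \<le> 1}" by (simp add: H2_def)
  then have "H2_norm (volterra g f) \<le> volterra_norm g"
    unfolding volterra_norm_def by (rule SUP_upper)
  also have "\<dots> \<le> ennreal C * weighted_norm c b" using g by (rule ineq)
  finally have main: "H2_norm (volterra g f) \<le> ennreal C * weighted_norm c b" .

  have E0: "E \<ge> 0" unfolding E_def by (intro sum_nonneg) (simp add: prod_nonneg)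
  have "(\<Sum>n. ennreal ((cmod (b (n + 2)))\<^sup>2 * weight c (n + 2))) = ennreal (\<Sum>d\<in>D. (cmod (b d))\<^sup>2 * weight c d)"
  proof (rule suminf_ennreal_shift_finite)
    show "n \<ge> 2" if "n \<in> D" for n using large(2)[OF that] by simp
    show "0 \<le> (cmod (b n))\<^sup>2 * weight c n" for n by (simp add: weight_def)
  qed (use finD in \<open>auto simp: b_def\<close>)
  \<comment> \<open>The factor \<open>d\<close> of the weight cancels one of the two factors
    \<open>1 / d\<close>. As \<open>c >= 0\<close>, the exponential is largest at the lower limit
    \<open>z ^ k\<close> for \<open>d\<close>.\<close>
  also have "(\<Sum>d\<in>D. (cmod (b d))\<^sup>2 * weight c d) \<le> (\<Sum>d\<in>D. (1 / real d) * exp (- c * S0))"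
  proof (intro sum_mono)
    fix d assume d: "d \<in> D"
    have d3: "real d \<ge> 3" "z ^ k \<le> real d" using large d by auto
    have "ln (z ^ k) \<le> ln (real d)" using d3 z by (subst ln_le_cancel_iff) auto
    then have l: "real k * ln z \<le> ln (real d)" using z by (simp add: ln_realpow)
    then have "ln (real k * ln z) \<le> ln (ln (real d))" using k by (subst ln_le_cancel_iff) auto
    also have "\<dots> \<le> loglog (real d)" using d3 by (subst loglog_eq_max) auto
    finally have "S0 \<le> sqrt (ln (real d) * loglog (real d))"
      unfolding S0_def using l k by (intro real_sqrt_le_mono mult_mono) auto
    then have "exp (- c * sqrt (ln (real d) * loglog (real d))) \<le> exp (- c * S0)"
      using c by (simp add: mult_left_mono)
    then have "(1 / real d) * exp (- c * sqrt (ln (real d) * loglog (real d))) \<le> (1 / real d) * exp (- c * S0)"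
      by (intro mult_left_mono) auto
    then show "(cmod (b d))\<^sup>2 * weight c d \<le> (1 / real d) * exp (- c * S0)"
      using d d3 by (simp add: b_def weight_def power2_eq_square norm_divide)
  qed
  also have "\<dots> = E * exp (- c * S0)"
    unfolding D_def E_def using inj_on_subset[OF inj KP]
    by (simp add: sum.reindex sum_distrib_right)
  finally have "weighted_norm c b \<le> ennreal_sqrt (ennreal (E * exp (- c * S0)))"
    unfolding weighted_norm_eq by (simp add: ennreal_sqrt_mono ennreal_leI)
  then have "weighted_norm c b \<le> ennreal (sqrt (E * exp (- c * S0)))"
    using E0 by (simp add: ennreal_sqrt_ennreal)
  then have "ennreal C * weighted_norm c b \<le> ennreal C * ennreal (sqrt (E * exp (- c * S0)))"
    by (intro mult_left_mono) auto
  also have "\<dots> = ennreal (C * sqrt (E * exp (- c * S0)))" using C by (simp add: ennreal_mult')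
  finally have upper: "H2_norm (volterra g f) \<le> ennreal (C * sqrt (E * exp (- c * S0)))"
    using main by (rule order_trans[rotated])

  define h where "h A = (\<Sum>B | B \<in> K \<and> B \<subseteq> A. 1 / real (\<Prod>B))" for A
  show ?thesis
  \<comment> \<open>The last step cancels a factor \<open>E\<close>; moreover \<open>E\<close>
    nonzero makes \<open>K\<close> nonempty, which gives \<open>L > 0\<close> and
    \<open>k <= m\<close>.\<close>
  proof (cases "E = 0")
    case True
    have "(\<Sum>A | A \<subseteq> P \<and> card A = k. \<Prod>p\<in>A. 1 / real p) = E"
      by (simp add: E_def K_def prod_dividef)
    with True show ?thesis by simp
  next
    case False
    then have "K \<noteq> {}" by (auto simp: E_def)
    then obtain A0 where A0: "A0 \<in> K" by blast
    have "real (\<Prod>A0) \<ge> 3" using large(2)[of "\<Prod>A0"] A0 by (auto simp: D_def)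
    moreover have "\<Prod>A0 \<le> \<Prod>P"
      using A0 P(1) pos[of "P - A0"] prod.subset_diff[of A0 P "\<lambda>p. p"] by (auto simp: K_def)
    ultimately have "real (\<Prod>P) \<ge> 3" by linarith
    then have L0: "L > 0" unfolding L_def by simp
    \<comment> \<open>In the convolution at \<open>\<Prod>A\<close> only the divisors
      \<open>\<Prod>B\<close> with \<open>B\<close> in \<open>K\<close> and \<open>B\<close> inside
      \<open>A\<close> are retained; the terms are nonnegative. For these \<open>ln d >= 1\<close>
      because \<open>d >= 3 >= exp 1\<close>, and the denominator is at most
      \<open>L\<close>.\<close>
    have coeff: "h A / (L * sqrt (2 ^ m)) \<le> cmod (volterra_coeff b a (\<Prod>A))" if A: "A \<subseteq> P" for A
    proof (cases "\<exists>B\<in>K. B \<subseteq> A")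
      case False
      then have "{B. B \<in> K \<and> B \<subseteq> A} = {}" by auto
      then have "h A = 0" unfolding h_def by (simp only: sum.empty)
      then show ?thesis by simp
    next
      case True
      then obtain B0 where B0: "B0 \<in> K" "B0 \<subseteq> A" by blast
      have finA: "finite A" using A P(1) finite_subset by blast
      define n where "n = \<Prod>A"
      have n1: "n \<ge> 1" unfolding n_def using A by (rule pos)
      define r where "r d = (if n div d \<in> N \<and> d \<in> D then (1 / sqrt (2 ^ m)) * (1 / real d * ln (real d)) else 0)" for d
      have r0: "r d \<ge> 0" for d by (cases "d = 0") (auto simp: r_def)
      have "n \<le> \<Prod>P"
        using A P(1) pos[of "P - A"] prod.subset_diff[of A P "\<lambda>p. p"] by (auto simp: n_def)
      then have "real n \<le> real (\<Prod>P)" by (simp only: of_nat_le_iff)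
      moreover have "real n > 0" using n1 by simp
      ultimately have "ln (real n) \<le> L" unfolding L_def
        using ln_le_cancel_iff[of "real n" "real (\<Prod>P)"] by linarith
      have "n \<ge> 3"
      proof -
        have "real (\<Prod>B0) \<ge> 3" using large(2)[of "\<Prod>B0"] B0 by (auto simp: D_def)
        moreover have "\<Prod>B0 \<le> \<Prod>A"
          using B0 finA A pos[of "A - B0"] prod.subset_diff[of B0 A "\<lambda>p. p"] by (auto simp: n_def)
        ultimately show ?thesis unfolding n_def by linarith
      qed
      then have lnn: "ln (real n) > 0" by simp
      have "h A / sqrt (2 ^ m) = (\<Sum>B | B \<in> K \<and> B \<subseteq> A. (1 / sqrt (2 ^ m)) * (1 / real (\<Prod>B)))"
        by (simp add: h_def sum_divide_distrib mult.commute)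
      also have "\<dots> \<le> (\<Sum>B | B \<in> K \<and> B \<subseteq> A. r (\<Prod>B))"
      proof (intro sum_mono)
        fix B assume "B \<in> {B. B \<in> K \<and> B \<subseteq> A}"
        then have B: "B \<in> K" "B \<subseteq> A" by auto
        define d where "d = \<Prod>B"
        define q where "q = \<Prod>(A - B)"
        have dD: "d \<in> D" using B by (auto simp: D_def d_def)
        then have d3: "real d \<ge> 3" by (rule large(2))
        have "n = q * d" unfolding n_def d_def q_def using B finA by (simp add: prod.subset_diff)
        then have "n div d = q" using d3 by simp
        moreover have "q \<in> N" using A by (auto simp: N_def q_def)
        moreover have "1 \<le> ln (real d)"
        proof -
          have "exp 1 \<le> real d" using d3 exp_le by linarith
          then show ?thesis using d3 by (subst ln_ge_iff) auto
        qed
        ultimately show "(1 / sqrt (2 ^ m)) * (1 / real (\<Prod>B)) \<le> r (\<Prod>B)"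
          unfolding d_def[symmetric] r_def using dD d3 by (auto intro!: divide_right_mono)
      qed
      also have "\<dots> = (\<Sum>d\<in>\<Prod> ` {B. B \<in> K \<and> B \<subseteq> A}. r d)"
        using inj KP by (subst sum.reindex) (auto intro: inj_on_subset)
      also have "\<dots> \<le> (\<Sum>d | d dvd n. r d)"
      proof (intro sum_mono2 r0)
        show "\<Prod> ` {B. B \<in> K \<and> B \<subseteq> A} \<subseteq> {d. d dvd n}"
          unfolding n_def using finA by (auto intro!: prod_dvd_prod_subset)
      qed (use n1 in auto)
      finally have hr: "h A / sqrt (2 ^ m) \<le> (\<Sum>d | d dvd n. r d)" .
      have "(\<Sum>d | d dvd n. a (n div d) * (b d * of_real (ln (real d)))) = of_real (\<Sum>d | d dvd n. r d)"
        unfolding of_real_sum by (intro sum.cong refl) (auto simp: a_def b_def r_def)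
      moreover have "0 \<le> (\<Sum>d | d dvd n. r d)" using r0 by (intro sum_nonneg)
      ultimately have "cmod (volterra_coeff b a n) = (\<Sum>d | d dvd n. r d) / ln (real n)"
        using lnn by (simp add: volterra_coeff_def norm_divide del: of_real_sum)
      moreover have "(h A / sqrt (2 ^ m)) / L \<le> (\<Sum>d | d dvd n. r d) / ln (real n)"
        using hr lnn \<open>ln (real n) \<le> L\<close> r0 by (intro frac_le sum_nonneg) auto
      ultimately show ?thesis by (simp add: n_def mult.commute)
    qed
    \<comment> \<open>Double counting: a set of size \<open>k\<close> lies in
      \<open>2 ^ (m - k)\<close> subsets of \<open>P\<close>, so the mean of \<open>h\<close> over
      all subsets is \<open>E / 2 ^ k\<close>. The Cauchy--Schwarz inequality below compares this
      mean with the mean square.\<close>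
    have hsum: "(\<Sum>A\<in>Pow P. h A) * 2 ^ k = 2 ^ m * E"
    proof -
      have "(\<Sum>A\<in>Pow P. h A) = (\<Sum>A\<in>Pow P. \<Sum>B\<in>K. if B \<subseteq> A then 1 / real (\<Prod>B) else 0)"
        unfolding h_def using finK by (intro sum.cong refl sum.mono_neutral_cong_left) auto
      also have "\<dots> = (\<Sum>B\<in>K. \<Sum>A\<in>Pow P. if B \<subseteq> A then 1 / real (\<Prod>B) else 0)" by (rule sum.swap)
      also have "\<dots> = (\<Sum>B\<in>K. 2 ^ (m - k) * (1 / real (\<Prod>B)))"
      proof (intro sum.cong refl)
        fix B assume B: "B \<in> K"
        have "(\<Sum>A\<in>Pow P. if B \<subseteq> A then 1 / real (\<Prod>B) else 0) = (\<Sum>A | B \<subseteq> A \<and> A \<subseteq> P. 1 / real (\<Prod>B))"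
          using P(1) by (intro sum.mono_neutral_cong_right) auto
        also have "\<dots> = real (card {A. B \<subseteq> A \<and> A \<subseteq> P}) * (1 / real (\<Prod>B))" by simp
        also have "\<dots> = 2 ^ (m - k) * (1 / real (\<Prod>B))"
          using B P(1) card_supersets[of P B] by (simp add: K_def m_def)
        finally show "(\<Sum>A\<in>Pow P. if B \<subseteq> A then 1 / real (\<Prod>B) else 0) = 2 ^ (m - k) * (1 / real (\<Prod>B))" .
      qed
      also have "\<dots> = 2 ^ (m - k) * E" by (simp add: E_def sum_distrib_left)
      finally have "(\<Sum>A\<in>Pow P. h A) * 2 ^ k = (2 ^ (m - k) * 2 ^ k) * E" by simp
      also have "2 ^ (m - k) * 2 ^ k = (2 ^ m :: real)"
      proof -
        have "k \<le> m" using A0 P(1) card_mono[of P A0] by (auto simp: K_def m_def)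
        then show ?thesis by (simp add: power_add[symmetric])
      qed
      finally show ?thesis .
    qed
    have h0: "h A \<ge> 0" for A unfolding h_def by (intro sum_nonneg) (simp add: prod_nonneg)
    have "(E / (2 ^ k * L))\<^sup>2 \<le> (\<Sum>n\<in>N. (cmod (volterra_coeff b a n))\<^sup>2)"
    proof -
      have "(\<Sum>A\<in>Pow P. h A)\<^sup>2 \<le> (\<Sum>A\<in>Pow P. 1\<^sup>2) * (\<Sum>A\<in>Pow P. (h A)\<^sup>2)"
        using Cauchy_Schwarz_ineq_sum[of "\<lambda>_. 1" h "Pow P"] by simp
      then have "(\<Sum>A\<in>Pow P. h A)\<^sup>2 \<le> 2 ^ m * (\<Sum>A\<in>Pow P. (h A)\<^sup>2)"
        using P(1) by (simp add: card_Pow m_def)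
      then have "((\<Sum>A\<in>Pow P. h A) / 2 ^ m)\<^sup>2 \<le> (\<Sum>A\<in>Pow P. (h A)\<^sup>2) / 2 ^ m"
        by (simp add: power_divide field_simps power2_eq_square)
      moreover have "(\<Sum>A\<in>Pow P. h A) / 2 ^ m = E / 2 ^ k"
        using hsum by (simp add: field_simps)
      ultimately have "(E / 2 ^ k)\<^sup>2 / L\<^sup>2 \<le> ((\<Sum>A\<in>Pow P. (h A)\<^sup>2) / 2 ^ m) / L\<^sup>2"
        by (intro divide_right_mono) auto
      then have "(E / (2 ^ k * L))\<^sup>2 \<le> (\<Sum>A\<in>Pow P. (h A)\<^sup>2) / (2 ^ m * L\<^sup>2)"
        by (simp add: power_divide power_mult_distrib)
      also have "\<dots> = (\<Sum>A\<in>Pow P. (h A / (L * sqrt (2 ^ m)))\<^sup>2)"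
        by (simp add: sum_divide_distrib power_divide power_mult_distrib mult.commute)
      also have "\<dots> \<le> (\<Sum>A\<in>Pow P. (cmod (volterra_coeff b a (\<Prod>A)))\<^sup>2)"
        using h0 L0 coeff by (intro sum_mono power_mono) auto
      also have "\<dots> = (\<Sum>n\<in>N. (cmod (volterra_coeff b a n))\<^sup>2)"
        unfolding N_def using inj by (simp add: sum.reindex)
      finally show ?thesis .
    qed
    then have "ennreal ((E / (2 ^ k * L))\<^sup>2) \<le> ennreal (\<Sum>n\<in>N. (cmod (volterra_coeff b a n))\<^sup>2)"
      by (rule ennreal_leI)
    also have "\<dots> \<le> (\<Sum>n. ennreal ((cmod (volterra_coeff b a (n + 1)))\<^sup>2))"
      using finN pos by (intro sum_le_suminf_ennreal_shift) (auto simp: N_def)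
    finally have "ennreal_sqrt (ennreal ((E / (2 ^ k * L))\<^sup>2)) \<le> H2_norm (volterra g f)"
      using H2_norm_eq[OF dirichlet_expansion_volterra[OF f g]] by (simp add: ennreal_sqrt_mono)
    then have "ennreal (E / (2 ^ k * L)) \<le> H2_norm (volterra g f)"
      using E0 L0 by (simp add: ennreal_sqrt_ennreal)
    with upper have "ennreal (E / (2 ^ k * L)) \<le> ennreal (C * sqrt (E * exp (- c * S0)))"
      by (rule order_trans[rotated])
    then have "E / (2 ^ k * L) \<le> C * sqrt (E * exp (- c * S0))"
      using C E0 by (subst (asm) ennreal_le_iff) auto
    then have "(E / (2 ^ k * L))\<^sup>2 \<le> (C * sqrt (E * exp (- c * S0)))\<^sup>2"
      using E0 L0 by (intro power_mono) auto
    also have "\<dots> = C\<^sup>2 * (E * exp (- c * S0))" using E0 by (simp add: power_mult_distrib)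
    also have "(E / (2 ^ k * L))\<^sup>2 = E * (E / (4 ^ k * L\<^sup>2))"
      by (simp add: power2_eq_square power_mult_distrib[symmetric])
    finally have "E * (E / (4 ^ k * L\<^sup>2)) \<le> E * (C\<^sup>2 * exp (- c * S0))" by (simp add: mult_ac)
    moreover have "E > 0" using E0 False by simp
    ultimately have "E / (4 ^ k * L\<^sup>2) \<le> C\<^sup>2 * exp (- c * S0)"
      by (rule mult_left_le_imp_le)
    then have "E \<le> C\<^sup>2 * exp (- c * S0) * (4 ^ k * L\<^sup>2)"
      using L0 by (simp add: divide_le_eq)
    moreover have "(\<Sum>A | A \<subseteq> P \<and> card A = k. \<Prod>p\<in>A. 1 / real p) = E"
      by (simp add: E_def K_def prod_dividef)
    ultimately show ?thesis by (simp add: L_def S0_def mult_ac)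
  qed
qed

text \<open>Subtract the upper bound up to \<open>N powr (9/16)\<close> from the lower bound up to
  \<open>N\<close>. With \<open>m = 3\<close> the former has the factor \<open>4/3\<close>, and
  \<open>4/3 * 9/16 = 3/4\<close>. So nearly \<open>1/4 * ln N\<close> remains in the window;
  dividing by \<open>ln N\<close> leaves more than \<open>1/5\<close>.\<close>

lemma sum_inverse_primes_window:
  "\<forall>\<^sub>F N :: nat in sequentially.
     1 / 5 \<le> (\<Sum>p | prime p \<and> real N powr (9 / 16) < real p \<and> p \<le> N. 1 / real p)"
proof -
  obtain B where B: "\<And>N. N \<ge> 1 \<Longrightarrow> ln (real N) - B \<le> (\<Sum>p | prime p \<and> p \<le> N. ln (real p) / real p)"
    using mertens_lower_bound by blast
  have "\<forall>\<^sub>F N :: nat in sequentially. 1 / 5 * ln (real N) \<le> 1 / 4 * ln (real N) - B - 4 / 3 * ln 3"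
    by real_asymp
  moreover have "\<forall>\<^sub>F N :: nat in sequentially. N \<ge> 2" by (rule eventually_ge_at_top)
  ultimately show ?thesis
  proof eventually_elim
    case (elim N)
    define z where "z = real N powr (9 / 16)"
    define M where "M = nat \<lfloor>z\<rfloor>"
    have z1: "z \<ge> 1" using elim by (simp add: z_def ge_one_powr_ge_zero)
    have M: "M \<ge> 1" "real M \<le> z" using z1 by (auto simp: M_def le_nat_floor intro: of_nat_floor)
    have zN: "z \<le> real N" using elim powr_mono[of "9/16" 1 "real N"] by (simp add: z_def)
    have lz: "ln z = 9 / 16 * ln (real N)" using elim by (simp add: z_def ln_powr)
    have lnN: "ln (real N) > 0" using elim by simp
    let ?W = "{p. prime p \<and> z < real p \<and> p \<le> N}"
    have le_M: "p \<le> M \<longleftrightarrow> real p \<le> z" for p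
      using z1 by (simp add: M_def le_nat_iff le_floor_iff)
    have "(\<Sum>p | prime p \<and> p \<le> N. ln (real p) / real p) =
        (\<Sum>p | prime p \<and> p \<le> M. ln (real p) / real p) + (\<Sum>p\<in>?W. ln (real p) / real p)"
      using zN by (subst sum.union_disjoint[symmetric]) (auto simp: le_M intro!: sum.cong intro: finite_subset[of _ "{..N}"])
    moreover have "(\<Sum>p | prime p \<and> p \<le> M. ln (real p) / real p) \<le> 3 / 4 * ln (real N) + 4 / 3 * ln 3"
    proof -
      \<comment> \<open>The prime bound only reaches \<open>N div m\<close>, so it is applied at
        \<open>3 * M\<close> to cover all primes up to \<open>M\<close>; the price is the constant
        \<open>4/3 * ln 3\<close>.\<close>
      have "(\<Sum>p | prime p \<and> p \<le> (3 * M) div 3. ln (real p) / real p) \<le> (1 + 1 / real 3) * ln (real (3 * M))"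
        using M by (intro sum_ln_prime_div_le) auto
      then have "(\<Sum>p | prime p \<and> p \<le> M. ln (real p) / real p) \<le> 4 / 3 * (ln 3 + ln (real M))"
        using M by (simp add: ln_mult)
      also have "ln (real M) \<le> ln z" using M z1 by (subst ln_le_cancel_iff) auto
      finally show ?thesis by (simp add: lz)
    qed
    moreover have "(\<Sum>p\<in>?W. ln (real p) / real p) \<le> ln (real N) * (\<Sum>p\<in>?W. 1 / real p)"
      unfolding sum_distrib_left
    proof (intro sum_mono)
      fix p assume p: "p \<in> ?W"
      then have "p > 0" using z1 by (auto intro: Nat.gr0I)
      then have "ln (real p) \<le> ln (real N)" using p elim by (subst ln_le_cancel_iff) auto
      then show "ln (real p) / real p \<le> ln (real N) * (1 / real p)" by (simp add: divide_right_mono)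
    qed
    moreover have "ln (real N) - B \<le> (\<Sum>p | prime p \<and> p \<le> N. ln (real p) / real p)"
      using elim by (intro B) simp
    ultimately have "ln (real N) * (1 / 5) \<le> ln (real N) * (\<Sum>p\<in>?W. 1 / real p)"
      using elim(1) by linarith
    then show ?case using lnN by (simp add: z_def)
  qed
qed

text \<open>The upper and lower bounds for the elementary symmetric sum contradict each other for
  large \<open>k\<close>. With \<open>N = k ^ k\<close> one has \<open>fact k <= N\<close>, and all
  exponents are measured on the scale \<open>k * ln k\<close>.\<close>

lemma volterra_norm_lower:
  assumes ineq: "\<And>b g. dirichlet_expansion b g \<Longrightarrow> volterra_norm g \<le> ennreal C * weighted_norm c b"
  shows "c \<le> 2 * sqrt 2"
proof (rule ccontr)
  assume "\<not> c \<le> 2 * sqrt 2"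
  then have c: "c > 2 * sqrt 2" by simp
  moreover have "2 * sqrt 2 > (0 :: real)" by simp
  ultimately have c0: "c > 0" by linarith
  define C' where "C' = max C 0"
  have C': "C' \<ge> 0" by (simp add: C'_def)
  have ineq': "volterra_norm g \<le> ennreal C' * weighted_norm c b" if "dirichlet_expansion b g" for b g
    using ineq[OF that] by (rule order_trans) (auto intro!: mult_right_mono ennreal_leI simp: C'_def)
  \<comment> \<open>\<open>\<delta> * x\<close> is the guaranteed excess of \<open>c * S0\<close>
    over \<open>3 * x\<close>.\<close>
  define \<delta> where "\<delta> = c * (3 / (2 * sqrt 2)) - 3"
  have "c * (3 / (2 * sqrt 2)) > (2 * sqrt 2) * (3 / (2 * sqrt 2))"
    using c by (intro mult_strict_right_mono) auto
  then have \<delta>: "\<delta> > 0" by (simp add: \<delta>_def)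
  have "\<forall>\<^sub>F k :: nat in sequentially. k \<ge> 1" by (rule eventually_ge_at_top)
  moreover have "\<forall>\<^sub>F k :: nat in sequentially. 1 \<le> 9 / 16 * ln (real k)" by real_asymp
  moreover have "\<forall>\<^sub>F k :: nat in sequentially. 3 \<le> exp (9 / 16 * (real k * ln (real k)))" by real_asymp
  moreover have "\<forall>\<^sub>F k :: nat in sequentially. real k * exp (- (9 / 16 * (real k * ln (real k)))) \<le> 1 / 10"
    by real_asymp
  \<comment> \<open>This contradicts the inequality reached at the end. Apart from the multiples of
    \<open>k * ln k\<close> all terms are of smaller order, so \<open>\<delta>\<close> absorbs
    them.\<close>
  moreover have "\<forall>\<^sub>F k :: nat in sequentially. 3 * (real k * ln (real k)) + real k * ln 4 + 2 * C'
      + 2 * ln (real k * ln (real k)) + real k * ln 10 < (3 + \<delta>) * (real k * ln (real k))"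
    using \<delta> by real_asymp
  moreover have "\<forall>\<^sub>F k :: nat in sequentially. 1 / 5 \<le>
      (\<Sum>p | prime p \<and> real (k ^ k) powr (9 / 16) < real p \<and> p \<le> k ^ k. 1 / real p)"
  proof -
    have "filterlim (\<lambda>k :: nat. k ^ k) at_top at_top"
    proof (rule filterlim_at_top_mono[OF filterlim_ident])
      show "\<forall>\<^sub>F k :: nat in sequentially. k \<le> k ^ k"
        using eventually_ge_at_top[of 1] by eventually_elim (auto intro: self_le_power)
    qed
    with sum_inverse_primes_window show ?thesis by (rule eventually_compose_filterlim)
  qed
  ultimately have "\<forall>\<^sub>F k :: nat in sequentially. False"
  proof eventually_elim
    case (elim k)
    define x where "x = real k * ln (real k)"
    \<comment> \<open>All divisors \<open>d\<close> used are at least \<open>z ^ k\<close>, so \<open>S0 \<ge> sqrt (9/8) * x\<close>; comparing with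
       \<open>fact k * N\<^sup>2 \<le> exp (3 * x)\<close> gives exactly \<open>c \<le> 3 / sqrt (9/8) = 2 * sqrt 2\<close>.\<close>
    define N where "N = k ^ k"
    define z where "z = real N powr (9 / 16)"
    define P where "P = {p. prime p \<and> z < real p \<and> p \<le> N}"
    have lnk: "ln (real k) \<ge> 16 / 9" using elim(2) by simp
    have k1: "real k \<ge> 1" using elim(1) by simp
    have "1 * 1 \<le> real k * ln (real k)" using k1 lnk by (intro mult_mono) auto
    then have x1: "x \<ge> 1" by (simp add: x_def)
    have N: "real N = exp x" using k1 by (simp add: N_def x_def exp_of_nat_mult)
    have z: "z = exp (9 / 16 * x)" by (simp add: z_def N powr_def)
    have finP: "finite P" unfolding P_def by (rule finite_subset[of _ "{..N}"]) auto
    define e where "e = (\<Sum>A | A \<subseteq> P \<and> card A = k. \<Prod>p\<in>A. 1 / real p)"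
    \<comment> \<open>The window contributes at least \<open>1/5\<close> and the removal of
      \<open>k\<close> primes costs at most \<open>k / z <= 1/10\<close>, which leaves
      \<open>\<eta> = 1/10\<close>.\<close>
    have "(1 / 10) ^ k \<le> fact k * e"
      unfolding e_def
    proof (rule elementary_symmetric_lower_bound[where \<epsilon> = "1 / z"])
      show "0 \<le> 1 / real p \<and> 1 / real p \<le> 1 / z" if "p \<in> P" for p
      proof -
        have "0 < z" "z \<le> real p" using that by (auto simp: P_def z)
        then show ?thesis by (intro conjI frac_le) auto
      qed
      have "1 / z = exp (- (9 / 16 * x))" unfolding z exp_minus by (rule inverse_eq_divide[symmetric])
      then have "real k * (1 / z) \<le> 1 / 10" using elim(4) by (simp only: x_def)
      moreover have "1 / 5 \<le> (\<Sum>p\<in>P. 1 / real p)" using elim(6) by (simp add: P_def N_def z_def)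
      ultimately show "1 / 10 + real k * (1 / z) \<le> (\<Sum>p\<in>P. 1 / real p)" by linarith
    qed (use finP in \<open>auto simp: z\<close>)
    have e0: "e \<ge> 0" unfolding e_def by (intro sum_nonneg prod_nonneg) auto
    define S0 where "S0 = sqrt (real k * ln z * ln (real k * ln z))"
    have lz: "real k * ln z = 9 / 16 * (real k * x)" by (simp add: z)
    have sq: "real k ^ 2 \<le> real k * ln z"
    proof -
      have "real k ^ 2 * 1 \<le> real k ^ 2 * (9 / 16 * ln (real k))" using elim(2) by (intro mult_left_mono) auto
      then show ?thesis unfolding lz by (simp add: x_def power2_eq_square mult_ac)
    qed
    have "1 \<le> real k ^ 2" using k1 by (simp add: one_le_power)
    with sq have lz1: "1 \<le> real k * ln z" by linarith
    have eb: "e \<le> C'\<^sup>2 * 4 ^ k * (ln (real (\<Prod>P)))\<^sup>2 * exp (- c * S0)"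
      unfolding e_def S0_def
    proof (rule elementary_symmetric_bound_of_volterra_bound[OF finP])
      show "z \<ge> 3" using elim(3) by (simp add: z x_def)
    qed (use ineq' lz1 C' c0 elim(1) in \<open>auto simp: P_def\<close>)
    \<comment> \<open>Bounding \<open>card P\<close> crudely by \<open>N = exp x\<close> is what
      produces the factor \<open>N^2\<close> after squaring.\<close>
    have lnP: "0 \<le> ln (real (\<Prod>P))" "ln (real (\<Prod>P)) \<le> exp x * x"
    proof -
      have pos: "real p > 0" if "p \<in> P" for p using that prime_gt_0_nat by (auto simp: P_def)
      have "ln (real (\<Prod>P)) = (\<Sum>p\<in>P. ln (real p))"
        using finP pos by (simp add: ln_prod)
      moreover have "0 \<le> (\<Sum>p\<in>P. ln (real p))"
        by (intro sum_nonneg ln_ge_zero) (auto simp: P_def dest: prime_ge_1_nat)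
      moreover have "(\<Sum>p\<in>P. ln (real p)) \<le> real (card P) * x"
      proof (intro sum_bounded_above)
        fix p assume p: "p \<in> P"
        then have "real p \<le> exp x" by (simp add: P_def N[symmetric])
        then have "ln (real p) \<le> ln (exp x)" using pos[OF p] by (subst ln_le_cancel_iff) auto
        then show "ln (real p) \<le> x" by simp
      qed
      moreover have "card P \<le> N"
      proof -
        have "card P \<le> card {1..N}"
          by (intro card_mono) (auto simp: P_def dest: prime_ge_1_nat)
        then show ?thesis by simp
      qed
      then have "real (card P) * x \<le> exp x * x" using x1 by (intro mult_right_mono) (auto simp: N[symmetric])
      ultimately show "0 \<le> ln (real (\<Prod>P))" "ln (real (\<Prod>P)) \<le> exp x * x" by linarith+
    qed
    \<comment> \<open>From \<open>k * ln z >= k^2\<close> the outer logarithm is at least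
      \<open>2 * ln k\<close>. Hence
      \<open>S0^2 >= 9/16 * k * x * 2 * ln k = 9/8 * x^2\<close>.\<close>
    have S0: "3 / (2 * sqrt 2) * x \<le> S0"
    proof -
      have "2 * ln (real k) = ln (real k ^ 2)" using k1 by (simp add: ln_realpow)
      also have "\<dots> \<le> ln (real k * ln z)" using sq k1 lz1 by (subst ln_le_cancel_iff) auto
      finally have "real k * ln z * (2 * ln (real k)) \<le> real k * ln z * ln (real k * ln z)"
        using lz1 by (intro mult_left_mono) auto
      then have "9 / 8 * x\<^sup>2 \<le> real k * ln z * ln (real k * ln z)"
        unfolding lz by (simp add: x_def power2_eq_square mult_ac)
      then have "sqrt (9 / 8 * x\<^sup>2) \<le> S0" unfolding S0_def by (rule real_sqrt_le_mono)
      moreover have "sqrt (9 / 8 * x\<^sup>2) = 3 / (2 * sqrt 2) * x"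
      proof (rule real_sqrt_unique)
        show "(3 / (2 * sqrt 2) * x)\<^sup>2 = 9 / 8 * x\<^sup>2" by (simp add: power_mult_distrib power_divide)
        show "0 \<le> 3 / (2 * sqrt 2) * x" using x1 by simp
      qed
      ultimately show ?thesis by simp
    qed
    have "exp (- (real k * ln 10)) = (1 / 10) ^ k"
      by (simp add: exp_minus exp_of_nat_mult power_one_over inverse_eq_divide)
    also have "\<dots> \<le> fact k * e" by fact
    also have "\<dots> \<le> exp x * e"
    proof -
      have "(fact k :: real) \<le> exp x"
        using fact_le_power[of k, where ?'a = real] N by (simp add: N_def)
      then show ?thesis using e0 by (rule mult_right_mono)
    qed
    also have "\<dots> \<le> exp x * (exp (2 * C') * exp (real k * ln 4) * (exp (2 * x) * exp (2 * ln x)) * exp (- ((3 + \<delta>) * x)))"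
    proof -
      have "C' \<le> exp C'" using exp_ge_add_one_self[of C'] by linarith
      then have 1: "C'\<^sup>2 \<le> exp (2 * C')" using C' by (simp add: exp_double power_mono)
      have 2: "4 ^ k = exp (real k * ln (4 :: real))" by (simp add: exp_of_nat_mult)
      have "(ln (real (\<Prod>P)))\<^sup>2 \<le> (exp x * x)\<^sup>2" using lnP by (intro power_mono)
      also have "\<dots> = exp (2 * x) * exp (2 * ln x)" using x1 by (simp add: exp_double power_mult_distrib)
      finally have 3: "(ln (real (\<Prod>P)))\<^sup>2 \<le> exp (2 * x) * exp (2 * ln x)" .
      have "c * (3 / (2 * sqrt 2) * x) \<le> c * S0" using S0 c0 by (intro mult_left_mono) auto
      then have 4: "exp (- c * S0) \<le> exp (- ((3 + \<delta>) * x))" by (simp add: \<delta>_def)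
      have "C'\<^sup>2 * 4 ^ k * (ln (real (\<Prod>P)))\<^sup>2 * exp (- c * S0) \<le>
          exp (2 * C') * exp (real k * ln 4) * (exp (2 * x) * exp (2 * ln x)) * exp (- ((3 + \<delta>) * x))"
        using 1 3 4 by (intro mult_mono) (auto simp: 2)
      with eb show ?thesis by (intro mult_left_mono) auto
    qed
    also have "\<dots> = exp (3 * x + real k * ln 4 + 2 * C' + 2 * ln x - (3 + \<delta>) * x)"
      by (simp add: exp_add[symmetric] algebra_simps)
    finally have "- (real k * ln 10) \<le> 3 * x + real k * ln 4 + 2 * C' + 2 * ln x - (3 + \<delta>) * x"
      by (simp only: exp_le_cancel_iff)
    then show False using elim(5) unfolding x_def[symmetric] by linarith
  qed
  then show False by simp
qed

theorem theorem4p3: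
  shows "(\<forall>c::real. c < 2 \<longrightarrow>
            (\<exists>C::real. C > 0 \<and>
               (\<forall>b g. dirichlet_expansion b g \<longrightarrow>
                  volterra_norm g \<le> ennreal C * weighted_norm c b)))
       \<and> (\<forall>c::real.
            (\<exists>C::real. \<forall>b g. dirichlet_expansion b g \<longrightarrow>
                  volterra_norm g \<le> ennreal C * weighted_norm c b)
            \<longrightarrow> c \<le> 2 * sqrt 2)"
proof (intro conjI allI impI)
  fix c :: real assume "c < 2"
  then show "\<exists>C::real. C > 0 \<and> (\<forall>b g. dirichlet_expansion b g \<longrightarrow>
      volterra_norm g \<le> ennreal C * weighted_norm c b)"
    by (rule volterra_norm_upper)
next
  fix c :: real
  assume "\<exists>C::real. \<forall>b g. dirichlet_expansion b g \<longrightarrow>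
      volterra_norm g \<le> ennreal C * weighted_norm c b"
  then obtain C where "\<And>b g. dirichlet_expansion b g \<Longrightarrow> volterra_norm g \<le> ennreal C * weighted_norm c b"
    by blast
  then show "c \<le> 2 * sqrt 2" by (rule volterra_norm_lower)
qed

end
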